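(* Let $w$ be a nonnegative weight function on $[1,\infty)$, and let $c_w$, $x_{k,n}$, $\lambda_{k,n}$, $\theta_{k,n}$, $s_{j,k}$, $t_{j,k}$, $G$ and $\mathcal{W}_{\gamma}$ be associated with $w$ as in the context. (i) Let $n\ge 1$. For $\mathcal{W}_{-1/2}$ on $G$, there is a minimal cubature rule of degree $4n-1$ with $\dim \Pi_{2n-1}^2+n$ nodes, namely $$c_w^2\int_G f(x,y)\,\mathcal{W}_{-\frac12}(x,y)\,dx\,dy=\frac14\sum_{k=1}^n{\sum_{j=1}^{k}}'\lambda_{j,n}\lambda_{k,n}\bigl[f(s_{j,k},t_{j,k})+f(t_{j,k},s_{j,k})+f(-s_{j,k},-t_{j,k})+f(-t_{j,k},-s_{j,k})\bigr]$$ for all $f\in\Pi_{4n-1}^2$, where ${\sum}'$ means that the term with $j=k$ is divided by $2$. (ii) Let $n\ge 2$. For $\mathcal{W}_{1/2}$ on $G$, there is a minimal cubature rule of degree $4n-3$ with $\dim\Pi_{2n-3}^2+n$ nodes, namely $$c_w^2\int_G f(x,y)\,\mathcal{W}_{\frac12}(x,y)\,dx\,dy=\frac14\sum_{k=2}^n\sum_{j=1}^{k-1}\lambda_{j,k}\bigl[f(s_{j,k},t_{j,k})+f(t_{j,k},s_{j,k})+f(-s_{j,k},-t_{j,k})+f(-t_{j,k},-s_{j,k})\bigr]$$ for all $f\in\Pi_{4n-3}^2$, where $\lambda_{j,k}=\lambda_{j,n}\lambda_{k,n}(\cosh\theta_{j,n}-\cosh\theta_{k,n})^2$.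
   Context: $\Pi_m^2$ is the space of real polynomials in two variables of total degree at most $m$; $\dim\Pi_m^2=(m+1)(m+2)/2$. Cubature rules. For a nonnegative weight $W$ on a domain $D\subset\mathbb{R}^2$, a cubature rule of degree (precision) $2m-1$ is a finite sum $\sum_{i=1}^N\mu_i f(x_i,y_i)$ (real weights $\mu_i$, distinct nodes $(x_i,y_i)\in\mathbb{R}^2$) that equals $\int_D fW\,dx\,dy$ (here multiplied by a fixed normalization constant) for all $f\in\Pi_{2m-1}^2$ but not for all $f\in\Pi_{2m}^2$. It is minimal if its number of nodes $N$ is the smallest among all cubature rules of the same precision for the same integral. One-variable setting. $w$ is a nonnegative function on $[1,\infty)$ with $0<\int_1^\infty w<\infty$ and all moments finite; $c_w$ is defined by $c_w\int_1^\infty w(x)\,dx=1$. $p_n(w;\cdot)$ is the orthogonal polynomial of degree $n$ with respect to $w$; its zeros $x_{1,n},\dots,x_{n,n}$ are distinct and lie in $(1,\infty)$. $\lambda_{k,n}>0$ are the weights of the Gaussian quadrature $c_w\int_1^\infty f(x)w(x)\,dx=\sum_{k=1}^n\lambda_{k,n}f(x_{k,n})$, valid for all one-variable polynomials $f$ of degree at most $2n-1$. Nodes. Define $\theta_{k,n}>0$ by $x_{k,n}=\cosh\theta_{k,n}$, and set $s_{j,k}=\cosh\frac{\theta_{j,n}-\theta_{k,n}}2$, $t_{j,k}=\cosh\frac{\theta_{j,n}+\theta_{k,n}}2$. Two-variable weights. Let $\triangle=\{(x,y):1<x<y<\infty\}$ and $\Omega=\{(u,v): u>2,\ u-1<v<u^2/4\}$;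 the map $(x,y)\mapsto(x+y,xy)$ is a bijection of $\triangle$ onto $\Omega$. For $\gamma>-1$ and $(u,v)\in\Omega$, define $W_\gamma(u,v)=w(x)w(y)\,|u^2-4v|^\gamma$, where $(x,y)\in\triangle$ is determined by $u=x+y$, $v=xy$. Let $G=(-\infty,-1]^2\cup[1,\infty)^2$ and define (for almost every $(x,y)\in G$, namely when $(2xy,x^2+y^2-1)\in\Omega$) $\mathcal{W}_\gamma(x,y)=W_\gamma(2xy,\,x^2+y^2-1)\,|x^2-y^2|$.
   Formalization: In (ii), false as printed for every n ≥ 2, the degree 4n-3 (and Π_{4n-3}) is corrected to 4n-5 and the number of nodes dim Π_{2n-3}+n to dim Π_{2n-3}+n-1; the displayed formula is unchanged. *)

theory Defs
  imports "HOL-Analysis.Analysis" "HOL-Library.Function_Algebras"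
    "HOL-Computational_Algebra.Polynomial"
begin

section \<open>Bivariate polynomials and cubature rules\<close>

definition poly2 :: "nat \<Rightarrow> (real \<times> real \<Rightarrow> real) set" where
  "poly2 m = {f. \<exists>c. \<forall>x y. f (x, y) = (\<Sum>i\<le>m. \<Sum>j\<le>m - i. c i j * x ^ i * y ^ j)}"

definition dim_poly2 :: "nat \<Rightarrow> nat" where
  "dim_poly2 m = vector_space.dim (\<lambda>(c::real) f z. c * f z) (poly2 m)"

definition integral_against :: "(real \<times> real \<Rightarrow> real) \<Rightarrow> (real \<times> real) set \<Rightarrow> (real \<times> real \<Rightarrow> real) \<Rightarrow> real" where
  "integral_against W D f = (LINT z:D|lborel. f z * W z)"

text \<open>
  A cubature rule is given by its finite set of nodes, which need not lie in the domain, and by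
  real weights of arbitrary sign, attached to the points of this set. The constant \<open>c\<close>
  normalises the integral. The precision \<open>d\<close> is exact: the rule fails for some polynomial
  of degree \<open>d + 1\<close>. The integrability condition makes sure that the failure is not an artefact of
  the convention that the integral of a non-integrable function is 0.
\<close>

definition cubature_rule ::
  "real \<Rightarrow> (real \<times> real \<Rightarrow> real) \<Rightarrow> (real \<times> real) set \<Rightarrow> nat \<Rightarrow> (real \<times> real) set \<Rightarrow> (real \<times> real \<Rightarrow> real) \<Rightarrow> bool"
where
  "cubature_rule c W D d X \<mu> \<longleftrightarrow>
     finite X \<and>
     (\<forall>f\<in>poly2 (d + 1). set_integrable lborel D (\<lambda>z. f z * W z)) \<and>
     (\<forall>f\<in>poly2 d. c * integral_against W D f = (\<Sum>z\<in>X. \<mu> z * f z)) \<and>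
     \<not> (\<forall>f\<in>poly2 (d + 1). c * integral_against W D f = (\<Sum>z\<in>X. \<mu> z * f z))"

definition minimal_cubature_rule ::
  "real \<Rightarrow> (real \<times> real \<Rightarrow> real) \<Rightarrow> (real \<times> real) set \<Rightarrow> nat \<Rightarrow> (real \<times> real) set \<Rightarrow> (real \<times> real \<Rightarrow> real) \<Rightarrow> bool"
where
  "minimal_cubature_rule c W D d X \<mu> \<longleftrightarrow>
     cubature_rule c W D d X \<mu> \<and>
     (\<forall>Y \<nu>. cubature_rule c W D d Y \<nu> \<longrightarrow> card X \<le> card Y)"


section \<open>The one-variable setting\<close>

definition weight_fun :: "(real \<Rightarrow> real) \<Rightarrow> bool" where
  "weight_fun w \<longleftrightarrow>
     (\<forall>t\<ge>1. 0 \<le> w t) \<and>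
     (\<forall>k::nat. set_integrable lborel {1..} (\<lambda>t. t ^ k * w t)) \<and>
     0 < (LINT t:{1..}|lborel. w t)"

definition c_const :: "(real \<Rightarrow> real) \<Rightarrow> real" where
  "c_const w = 1 / (LINT t:{1..}|lborel. w t)"

definition orthogonal_poly :: "(real \<Rightarrow> real) \<Rightarrow> nat \<Rightarrow> real poly \<Rightarrow> bool" where
  "orthogonal_poly w n p \<longleftrightarrow>
     p \<noteq> 0 \<and> degree p = n \<and>
     (\<forall>q. degree q < n \<longrightarrow> (LINT t:{1..}|lborel. poly p t * poly q t * w t) = 0)"

definition gauss_quadrature :: "(real \<Rightarrow> real) \<Rightarrow> nat \<Rightarrow> (nat \<Rightarrow> real) \<Rightarrow> (nat \<Rightarrow> real) \<Rightarrow> bool" where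
  "gauss_quadrature w n x lam \<longleftrightarrow>
     (\<forall>q. degree q \<le> 2 * n - 1 \<longrightarrow>
        c_const w * (LINT t:{1..}|lborel. poly q t * w t) = (\<Sum>k=1..n. lam k * poly q (x k)))"


section \<open>Two-variable weights\<close>

definition Triangle :: "(real \<times> real) set" where
  "Triangle = {(x, y). 1 < x \<and> x < y}"

definition Omega :: "(real \<times> real) set" where
  "Omega = {(u, v). 2 < u \<and> u - 1 < v \<and> v < u\<^sup>2 / 4}"

text \<open>
  Outside \<open>Omega\<close> the weight is extended by 0. For \<open>(x, y)\<close> in \<open>G_dom\<close> the point
  \<open>(2xy, x^2 + y^2 - 1)\<close> lies outside \<open>Omega\<close> only if \<open>x = y\<close> or one of
  \<open>\<bar>x\<bar>\<close>, \<open>\<bar>y\<bar>\<close> is 1, which is a null set.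
\<close>

definition W_weight :: "(real \<Rightarrow> real) \<Rightarrow> real \<Rightarrow> real \<times> real \<Rightarrow> real" where
  "W_weight w \<gamma> = (\<lambda>(u, v).
     if (u, v) \<in> Omega
     then (case (THE z. z \<in> Triangle \<and> fst z + snd z = u \<and> fst z * snd z = v) of
             (x, y) \<Rightarrow> w x * w y * \<bar>u\<^sup>2 - 4 * v\<bar> powr \<gamma>)
     else 0)"

definition G_dom :: "(real \<times> real) set" where
  "G_dom = {..-1} \<times> {..-1} \<union> {1..} \<times> {1..}"

definition calW :: "(real \<Rightarrow> real) \<Rightarrow> real \<Rightarrow> real \<times> real \<Rightarrow> real" where
  "calW w \<gamma> = (\<lambda>(x, y). W_weight w \<gamma> (2 * x * y, x\<^sup>2 + y\<^sup>2 - 1) * \<bar>x\<^sup>2 - y\<^sup>2\<bar>)"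


section \<open>The two rules\<close>

definition s_node :: "(nat \<Rightarrow> real) \<Rightarrow> nat \<Rightarrow> nat \<Rightarrow> real" where
  "s_node \<theta> j k = cosh ((\<theta> j - \<theta> k) / 2)"

definition t_node :: "(nat \<Rightarrow> real) \<Rightarrow> nat \<Rightarrow> nat \<Rightarrow> real" where
  "t_node \<theta> j k = cosh ((\<theta> j + \<theta> k) / 2)"

definition orbit_sum :: "(real \<times> real \<Rightarrow> real) \<Rightarrow> real \<Rightarrow> real \<Rightarrow> real" where
  "orbit_sum f s t = f (s, t) + f (t, s) + f (- s, - t) + f (- t, - s)"

text \<open>
  For \<open>n \<ge> 2\<close> the second sum below has \<open>2n(n - 1) = dim_poly2 (2n - 3) + n - 1\<close> nodes. As a rule
  for \<open>calW w (1/2)\<close> its precision is \<open>4n - 5\<close> and it cannot be \<open>4n - 3\<close>: there are fewer nodes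
  than \<open>dim_poly2 (2n - 2)\<close>, so some nonzero polynomial of degree at most \<open>2n - 2\<close>
  vanishes at all of them, and its square has positive integral.
\<close>

definition rule_minus :: "nat \<Rightarrow> (nat \<Rightarrow> real) \<Rightarrow> (nat \<Rightarrow> real) \<Rightarrow> (real \<times> real \<Rightarrow> real) \<Rightarrow> real" where
  "rule_minus n lam \<theta> f =
     1 / 4 * (\<Sum>k=1..n. \<Sum>j=1..k. (if j = k then 1 / 2 else 1) *
       (lam j * lam k * orbit_sum f (s_node \<theta> j k) (t_node \<theta> j k)))"

definition rule_plus :: "nat \<Rightarrow> (nat \<Rightarrow> real) \<Rightarrow> (nat \<Rightarrow> real) \<Rightarrow> (real \<times> real \<Rightarrow> real) \<Rightarrow> real" where
  "rule_plus n lam \<theta> f =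
     1 / 4 * (\<Sum>k=2..n. \<Sum>j=1..k - 1.
       lam j * lam k * (cosh (\<theta> j) - cosh (\<theta> k))\<^sup>2 *
         orbit_sum f (s_node \<theta> j k) (t_node \<theta> j k))"

end

theory Submission
  imports Defs
begin

text \<open>
  Under \<open>X + Y = 2xy\<close>, \<open>XY = x\<^sup>2 + y\<^sup>2 - 1\<close>, the domain \<open>G\<close> is, up to a null set, four
  symmetric copies of the triangle \<open>1 < X < Y\<close>. In the coordinates \<open>X = cosh \<phi>\<close>, \<open>Y = cosh \<theta>\<close>,
  \<open>x = cosh ((\<theta> - \<phi>) / 2)\<close>, \<open>y = cosh ((\<theta> + \<phi>) / 2)\<close> the weight becomes
  \<open>w X * w Y * (Y - X) ^ e / 4\<close> with \<open>e = 2\<gamma> + 1\<close>. Since the sum of a polynomial of degree at most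
  \<open>2M + 1\<close> over the four symmetries is a polynomial of degree at most \<open>M\<close> in each of \<open>X\<close> and \<open>Y\<close>,
  the product of two Gaussian quadratures integrates it exactly as soon as \<open>M + e \<le> 2n - 1\<close>.
  The resulting rules of degree \<open>4m - 1\<close> have \<open>2m(m + 1)\<close> nodes, which is Moeller's lower bound for
  centrally symmetric integrals; by dimension some nonzero polynomial of degree \<open>2m\<close> vanishes at all
  nodes, and its square shows that the degree of precision is exact.
\<close>

section \<open>Bivariate polynomials\<close>

text \<open>The exponent \<open>e\<close> has two sources: \<open>u\<^sup>2 - 4v\<close> equals
  \<open>(Y - X)\<^sup>2\<close>, so the weight contributes \<open>2\<gamma>\<close>, and the
  Jacobian contributes one more factor \<open>Y - X\<close>. Only integrals over the whole square
  split into products, so the triangle must be reflected in the diagonal; this is where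
  \<open>e\<close> has to be even. With \<open>e = 0\<close> and \<open>e = 2\<close> the condition
  \<open>M + e \<le> 2n - 1\<close> allows \<open>M = 2n - 1\<close> and \<open>M = 2n - 3\<close>,
  that is degrees \<open>4n - 1\<close> and \<open>4n - 5\<close>. On the diagonal of the grid of
  Gaussian nodes the factor \<open>(Y - X)^e\<close> is 1 for \<open>e = 0\<close>, where each
  diagonal pair is its own reflection and gets half a weight, and 0 for \<open>e = 2\<close>, where
  these pairs drop out. This leaves n(n+1)/2 or n(n-1)/2 orbits of four nodes each, that is 2m(m+1)
  nodes with m = n or m = n - 1. The planar change of variables is assembled from one-dimensional
  substitutions (\<open>cosh\<close> in each coordinate, then a shear) for nonnegative integrands.
  It is recorded as an equality of measures, so that integrability and integrals of signed functions
  transfer together.\<close>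

definition mon :: "nat \<times> nat \<Rightarrow> real \<times> real \<Rightarrow> real" where
  "mon e z = fst z ^ fst e * snd z ^ snd e"

definition expo :: "nat \<Rightarrow> (nat \<times> nat) set" where
  "expo m = (SIGMA i:{..m}. {..m - i})"

lemma finite_expo [simp, intro]: "finite (expo m)"
  by (simp add: expo_def)

lemma mem_expo: "e \<in> expo m \<longleftrightarrow> fst e + snd e \<le> m"
  by (cases e) (auto simp: expo_def)

lemma mon_mult: "mon e z * mon e' z = mon (e + e') z"
  by (simp add: mon_def power_add)

lemma mon_zero [simp]: "mon (0, 0) z = 1"
  by (simp add: mon_def)

lemma mon_uminus: "mon e (- z) = (- 1) ^ (fst e + snd e) * mon e z"
  unfolding mon_def power_add
  by (metis (no_types, opaque_lifting) ab_semigroup_mult_class.mult_ac(1) fst_uminus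
      mult.left_commute power_minus snd_uminus)

lemma borel_measurable_mon [measurable]: "mon e \<in> borel_measurable borel"
  unfolding mon_def borel_prod[symmetric] by measurable

lemma poly2_eq: "f \<in> poly2 m \<longleftrightarrow> (\<exists>c. f = (\<lambda>z. \<Sum>e\<in>expo m. c e * mon e z))"
proof -
  have *: "(\<Sum>i\<le>m. \<Sum>j\<le>m - i. c (i, j) * x ^ i * y ^ j) = (\<Sum>e\<in>expo m. c e * mon e (x, y))"
    for c :: "nat \<times> nat \<Rightarrow> real" and x y
    unfolding expo_def
    by (subst sum.Sigma) (auto simp: mon_def mult.assoc intro!: sum.cong)
  show ?thesis
  proof
    assume "f \<in> poly2 m"
    then obtain c where c: "\<And>x y. f (x, y) = (\<Sum>i\<le>m. \<Sum>j\<le>m - i. c i j * x ^ i * y ^ j)"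
      by (auto simp: poly2_def)
    have "f z = (\<Sum>e\<in>expo m. case_prod c e * mon e z)" for z
      using *[of "case_prod c" "fst z" "snd z"] c[of "fst z" "snd z"] by simp
    then show "\<exists>c. f = (\<lambda>z. \<Sum>e\<in>expo m. c e * mon e z)" by blast
  next
    assume "\<exists>c. f = (\<lambda>z. \<Sum>e\<in>expo m. c e * mon e z)"
    then obtain c where c: "f = (\<lambda>z. \<Sum>e\<in>expo m. c e * mon e z)" by blast
    then show "f \<in> poly2 m"
      unfolding poly2_def by (auto simp: *[symmetric] intro!: exI[of _ "\<lambda>i j. c (i, j)"])
  qed
qed

lemma poly2_sum_mon:
  assumes "E \<subseteq> expo m"
  shows "(\<lambda>z. \<Sum>e\<in>E. c e * mon e z) \<in> poly2 m"
proof -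
  have "(\<Sum>e\<in>E. c e * mon e z) = (\<Sum>e\<in>expo m. (if e \<in> E then c e else 0) * mon e z)" for z
    using assms by (intro sum.mono_neutral_cong_left) auto
  then show ?thesis unfolding poly2_eq by (auto intro!: exI[of _ "\<lambda>e. if e \<in> E then c e else 0"])
qed

lemma poly2_mon: "fst e + snd e \<le> m \<Longrightarrow> mon e \<in> poly2 m"
  using poly2_sum_mon[of "{e}" m "\<lambda>_. 1"] by (simp add: mem_expo fun_eq_iff)

lemma poly2_add: "f \<in> poly2 m \<Longrightarrow> g \<in> poly2 m \<Longrightarrow> (\<lambda>z. f z + g z) \<in> poly2 m"
proof -
  assume "f \<in> poly2 m" "g \<in> poly2 m"
  then obtain c d where "f = (\<lambda>z. \<Sum>e\<in>expo m. c e * mon e z)"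
    "g = (\<lambda>z. \<Sum>e\<in>expo m. d e * mon e z)" unfolding poly2_eq by auto
  then show ?thesis unfolding poly2_eq
    by (intro exI[of _ "\<lambda>e. c e + d e"]) (auto simp: algebra_simps sum.distrib)
qed

lemma poly2_cmult: "f \<in> poly2 m \<Longrightarrow> (\<lambda>z. c * f z) \<in> poly2 m"
  for c :: real
proof -
  assume "f \<in> poly2 m"
  then obtain d where "f = (\<lambda>z. \<Sum>e\<in>expo m. d e * mon e z)" unfolding poly2_eq by auto
  then show ?thesis unfolding poly2_eq
    by (intro exI[of _ "\<lambda>e. c * d e"]) (auto simp: algebra_simps sum_distrib_left)
qed

lemma poly2_0: "(\<lambda>z. 0) \<in> poly2 m"
  using poly2_sum_mon[of "{}" m] by simp

lemma poly2_sum: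
  "(\<And>i. i \<in> I \<Longrightarrow> f i \<in> poly2 m) \<Longrightarrow> (\<lambda>z. \<Sum>i\<in>I. f i z) \<in> poly2 m"
  by (induction I rule: infinite_finite_induct) (auto simp: poly2_0 intro: poly2_add)

lemma poly2_mult:
  assumes "f \<in> poly2 a" "g \<in> poly2 b"
  shows "(\<lambda>z. f z * g z) \<in> poly2 (a + b)"
proof -
  obtain c d where f: "f = (\<lambda>z. \<Sum>e\<in>expo a. c e * mon e z)"
    and g: "g = (\<lambda>z. \<Sum>e\<in>expo b. d e * mon e z)" using assms unfolding poly2_eq by auto
  have "(\<lambda>z. \<Sum>e\<in>expo a. \<Sum>e'\<in>expo b. (c e * d e') * mon (e + e') z) \<in> poly2 (a + b)"
    by (intro poly2_sum poly2_cmult poly2_mon) (auto simp: mem_expo)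
  also have "(\<lambda>z. \<Sum>e\<in>expo a. \<Sum>e'\<in>expo b. (c e * d e') * mon (e + e') z) = (\<lambda>z. f z * g z)"
    by (simp add: f g sum_product mon_mult[symmetric] mult.assoc mult.left_commute fun_eq_iff)
  finally show ?thesis .
qed

lemma poly2_mono: "a \<le> b \<Longrightarrow> poly2 a \<subseteq> poly2 b"
  using poly2_sum_mon[of "expo a" b] by (force simp: poly2_eq[of _ a] mem_expo)

lemma borel_measurable_poly2: "f \<in> poly2 m \<Longrightarrow> f \<in> borel_measurable borel"
  unfolding poly2_eq by (auto intro!: borel_measurable_sum borel_measurable_times)

text \<open>Filling up to a square of exponents and nesting the sums gives a one-variable polynomial
  in \<open>fst z\<close> whose coefficients are one-variable polynomials in \<open>snd z\<close>.
  Univariate facts about roots can then be applied twice.\<close>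

lemma sum_mon_eq_polyfun:
  assumes "finite E"
  obtains N where "\<And>z. (\<Sum>e\<in>E. c e * mon e z) =
     (\<Sum>i\<le>N. (\<Sum>j\<le>N. (if (i, j) \<in> E then c (i, j) else 0) * snd z ^ j) * fst z ^ i)"
    and "\<And>e. e \<in> E \<Longrightarrow> fst e \<le> N \<and> snd e \<le> N"
proof -
  define N where "N = (\<Sum>e\<in>E. fst e + snd e)"
  have N: "fst e \<le> N \<and> snd e \<le> N" if "e \<in> E" for e
    using member_le_sum[of e E "\<lambda>e. fst e + snd e"] that assms by (simp add: N_def)
  have "(\<Sum>e\<in>E. c e * mon e z) =
     (\<Sum>i\<le>N. (\<Sum>j\<le>N. (if (i, j) \<in> E then c (i, j) else 0) * snd z ^ j) * fst z ^ i)" for z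
  proof -
    have "(\<Sum>e\<in>E. c e * mon e z) = (\<Sum>e\<in>{..N} \<times> {..N}. (if e \<in> E then c e else 0) * mon e z)"
      using N by (intro sum.mono_neutral_cong_left) fastforce+
    also have "\<dots> = (\<Sum>i\<le>N. \<Sum>j\<le>N. (if (i, j) \<in> E then c (i, j) else 0) * mon (i, j) z)"
      by (simp add: sum.cartesian_product)
    finally show ?thesis
      by (simp add: mon_def sum_distrib_left sum_distrib_right mult_ac)
  qed
  with N that show ?thesis by blast
qed

lemma mon_independent:
  assumes "finite E" and zero: "\<And>z. (\<Sum>e\<in>E. c e * mon e z) = 0" and "e \<in> E"
  shows "c e = 0"
proof -
  obtain N where N: "\<And>z. (\<Sum>e\<in>E. c e * mon e z) =
     (\<Sum>i\<le>N. (\<Sum>j\<le>N. (if (i, j) \<in> E then c (i, j) else 0) * snd z ^ j) * fst z ^ i)"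
    "\<And>e. e \<in> E \<Longrightarrow> fst e \<le> N \<and> snd e \<le> N"
    using sum_mon_eq_polyfun[OF assms(1)] by blast
  have "\<forall>x. (\<Sum>i\<le>N. (\<Sum>j\<le>N. (if (i, j) \<in> E then c (i, j) else 0) * y ^ j) * x ^ i) = 0" for y
    using N(1)[of "(_, y)"] zero by simp
  then have coeff: "\<forall>i\<le>N. (\<Sum>j\<le>N. (if (i, j) \<in> E then c (i, j) else 0) * y ^ j) = 0" for y
    unfolding polyfun_eq_0 by blast
  have "(if (i, j) \<in> E then c (i, j) else 0) = 0" if "i \<le> N" "j \<le> N" for i j
  proof -
    have "\<forall>y. (\<Sum>j\<le>N. (if (i, j) \<in> E then c (i, j) else 0) * y ^ j) = 0"
      using coeff that by blast
    then show ?thesis using that unfolding polyfun_eq_0 by blast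
  qed
  from this[of "fst e" "snd e"] show ?thesis using N(2)[OF \<open>e \<in> E\<close>] \<open>e \<in> E\<close> by simp
qed

text \<open>For all but finitely many \<open>y\<close> some coefficient of the polynomial in
  \<open>x\<close> is nonzero, so that slice has finitely many roots. Fubini for null sets does the
  rest.\<close>

lemma poly2_AE_nonzero:
  assumes "f \<in> poly2 m" and "f \<noteq> (\<lambda>z. 0)"
  shows "AE z in lborel. f z \<noteq> 0"
proof -
  obtain c where f: "f = (\<lambda>z. \<Sum>e\<in>expo m. c e * mon e z)" using assms unfolding poly2_eq by auto
  obtain N where N: "\<And>z. f z =
     (\<Sum>i\<le>N. (\<Sum>j\<le>N. (if (i, j) \<in> expo m then c (i, j) else 0) * snd z ^ j) * fst z ^ i)"
    unfolding f using sum_mon_eq_polyfun[OF finite_expo[of m], where c = c] by blast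
  define a where "a i j = (if (i, j) \<in> expo m then c (i, j) else 0)" for i j
  have fa: "f (x, y) = (\<Sum>i\<le>N. (\<Sum>j\<le>N. a i j * y ^ j) * x ^ i)" for x y
    unfolding a_def using N[of "(x, y)"] by (simp only: fst_conv snd_conv)
  have "\<exists>i\<le>N. \<exists>j\<le>N. a i j \<noteq> 0"
  proof (rule ccontr)
    assume "\<not> (\<exists>i\<le>N. \<exists>j\<le>N. a i j \<noteq> 0)"
    then have "f (x, y) = 0" for x y unfolding fa by simp
    with assms show False by (auto simp: fun_eq_iff)
  qed
  then obtain i j where ij: "i \<le> N" "j \<le> N" "a i j \<noteq> 0" by blast
  have fin: "finite {y::real. (\<Sum>j\<le>N. a i j * y ^ j) = 0}"
    unfolding polyfun_finite_roots using ij by blast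
  have "AE y in lborel. y \<notin> {y::real. (\<Sum>j\<le>N. a i j * y ^ j) = 0}"
    by (rule AE_not_in) (simp add: fin finite_imp_null_set_lborel)
  moreover have "AE x in lborel. f (x, y) \<noteq> 0" if "(\<Sum>j\<le>N. a i j * y ^ j) \<noteq> 0" for y
  proof -
    have "finite {x. f (x, y) = 0}"
      unfolding fa polyfun_finite_roots using that ij by blast
    then have "AE x in lborel. x \<notin> {x. f (x, y) = 0}"
      by (intro AE_not_in) (simp add: finite_imp_null_set_lborel)
    then show ?thesis by simp
  qed
  ultimately have *: "AE y in lborel. AE x in lborel. f (x, y) \<noteq> 0"
    by (auto elim!: eventually_mono)
  have m: "f \<in> borel_measurable (lborel \<Otimes>\<^sub>M lborel)"
    using borel_measurable_poly2[OF assms(1)] by (simp add: lborel_prod)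
  \<comment> \<open>The slices above fix \<open>y\<close>, while the product measure expects
    \<open>x\<close> as the outer variable.\<close>
  have "AE x in lborel. AE y in lborel. f (x, y) \<noteq> 0"
    by (subst lborel_pair.AE_commute) (use m * in \<open>measurable\<close>)
  then show ?thesis
    unfolding lborel_prod[symmetric] by (intro lborel_pair.AE_pair_measure) (use m in measurable)
qed

section \<open>Dimension of the polynomial spaces\<close>

lemma card_expo: "card (expo m) = (m + 1) * (m + 2) div 2"
proof -
  have "card (expo m) = (\<Sum>i\<le>m. m - i + 1)"
    by (simp add: expo_def)
  also have "\<dots> = (\<Sum>i\<le>m. i + 1)"
    using sum.nat_diff_reindex[of "\<lambda>i. i + 1" "Suc m"]
    by (simp add: lessThan_Suc_atMost)
  also have "\<dots> = (m + 1) * (m + 2) div 2"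
    by (induction m) auto
  finally show ?thesis .
qed

interpretation fun_vs: vector_space "\<lambda>(c::real) (f :: real \<times> real \<Rightarrow> real) z. c * f z"
  by unfold_locales (auto simp: algebra_simps fun_eq_iff)

lemma sum_fun_eq: "sum f A = (\<lambda>z. \<Sum>a\<in>A. f a z)"
  for f :: "'a \<Rightarrow> 'b \<Rightarrow> real"
  by (induction A rule: infinite_finite_induct) (auto simp: fun_eq_iff)

lemma inj_mon: "inj mon"
proof (rule injI)
  fix e e' assume "mon e = mon e'"
  show "e = e'"
  proof (rule ccontr)
    assume "e \<noteq> e'"
    have "(\<Sum>d\<in>{e, e'}. (if d = e then 1 else - 1) * mon d z) = 0" for z
      using \<open>mon e = mon e'\<close> \<open>e \<noteq> e'\<close> by simp
    from mon_independent[OF _ this, of e] show False by simp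
  qed
qed

lemma dim_poly2_eq: "dim_poly2 m = (m + 1) * (m + 2) div 2"
  unfolding dim_poly2_def
proof (rule fun_vs.dim_unique[where B = "mon ` expo m"])
  show "mon ` expo m \<subseteq> poly2 m" by (auto simp: mem_expo intro: poly2_mon)
  show "poly2 m \<subseteq> fun_vs.span (mon ` expo m)"
  proof
    fix f assume "f \<in> poly2 m"
    then obtain c where "f = (\<lambda>z. \<Sum>e\<in>expo m. c e * mon e z)" unfolding poly2_eq by auto
    then have "f = (\<Sum>e\<in>expo m. (\<lambda>z. c e * mon e z))" by (simp add: sum_fun_eq)
    moreover have "\<dots> \<in> fun_vs.span (mon ` expo m)"
      by (intro fun_vs.span_sum fun_vs.span_scale fun_vs.span_base imageI)
    ultimately show "f \<in> fun_vs.span (mon ` expo m)" by simp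
  qed
  show "card (mon ` expo m) = (m + 1) * (m + 2) div 2"
    by (subst card_image) (auto simp: card_expo intro: inj_on_subset[OF inj_mon])
  show "\<not> fun_vs.dependent (mon ` expo m)"
  proof
    assume "fun_vs.dependent (mon ` expo m)"
    then obtain u g where u: "g \<in> mon ` expo m" "u g \<noteq> 0"
      and "(\<Sum>f\<in>mon ` expo m. (\<lambda>z. u f * f z)) = 0"
      by (subst (asm) fun_vs.dependent_finite) auto
    then have "(\<Sum>e\<in>expo m. u (mon e) * mon e z) = 0" for z
      by (subst (asm) sum.reindex)
        (auto intro: inj_on_subset[OF inj_mon] simp: sum_fun_eq dest!: fun_cong[of _ _ z])
    from mon_independent[OF _ this] u show False by auto
  qed
qed


section \<open>Lower bound for centrally symmetric functionals\<close>

text \<open>Gaussian elimination by induction on the equations. It is used with monomials evaluated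
  at nodes, where a solution is a nonzero polynomial vanishing at the nodes.\<close>

lemma underdetermined_system:
  fixes a :: "'e \<Rightarrow> 'y \<Rightarrow> real"
  assumes "finite Y" "finite E" "card Y < card E"
  shows "\<exists>c. (\<exists>e\<in>E. c e \<noteq> 0) \<and> (\<forall>y\<in>Y. (\<Sum>e\<in>E. c e * a e y) = 0)"
  using assms
proof (induction Y arbitrary: E a rule: finite_induct)
  case empty
  then show ?case by (auto intro!: exI[of _ "\<lambda>_. 1"] simp: card_gt_0_iff)
next
  case (insert y Y)
  show ?case
  proof (cases "\<forall>e\<in>E. a e y = 0")
    case True
    have "card Y < card E" using insert by simp
    from insert.IH[OF insert.prems(1) this] True show ?thesis by fastforce
  next
    case False
    then obtain e0 where e0: "e0 \<in> E" "a e0 y \<noteq> 0" by blast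
    let ?E = "E - {e0}"
    have "card Y < card ?E" using insert e0 by simp
    \<comment> \<open>The equation at \<open>y\<close> is used to eliminate the unknown
      \<open>e0\<close> from all the others; its own value is then read off from that
      equation.\<close>
    from insert.IH[OF _ this, of "\<lambda>e y'. a e y' - a e y / a e0 y * a e0 y'"] insert.prems
    obtain c where c: "\<exists>e\<in>?E. c e \<noteq> 0"
      "\<And>y'. y' \<in> Y \<Longrightarrow> (\<Sum>e\<in>?E. c e * (a e y' - a e y / a e0 y * a e0 y')) = 0"
      by blast
    define d where "d = c(e0 := - (\<Sum>e\<in>?E. c e * a e y) / a e0 y)"
    have d: "(\<Sum>e\<in>E. d e * a e y') = d e0 * a e0 y' + (\<Sum>e\<in>?E. c e * a e y')" for y'
      using e0 insert.prems
      by (subst sum.remove[of E e0]) (auto simp: d_def intro!: sum.cong)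
    have "(\<Sum>e\<in>E. d e * a e y) = 0"
      unfolding d using e0 by (simp add: d_def)
    moreover have "(\<Sum>e\<in>E. d e * a e y') = 0" if "y' \<in> Y" for y'
    proof -
      have "(\<Sum>e\<in>?E. c e * a e y') = (\<Sum>e\<in>?E. c e * a e y / a e0 y * a e0 y')"
        using c(2)[OF that] by (simp add: algebra_simps sum_subtractf)
      also have "\<dots> = (\<Sum>e\<in>?E. c e * a e y) / a e0 y * a e0 y'"
        by (simp add: sum_distrib_right sum_divide_distrib)
      finally show ?thesis unfolding d by (simp add: d_def)
    qed
    moreover have "\<exists>e\<in>E. d e \<noteq> 0" using c(1) by (auto simp: d_def)
    ultimately show ?thesis by blast
  qed
qed

definition odd_expo :: "nat \<Rightarrow> (nat \<times> nat) set" where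
  "odd_expo m = {e \<in> expo m. odd (fst e + snd e)}"

text \<open>Passing from m to m + 1 adds the 2m + 2 monomials of degree exactly 2m + 1. For m = 0
  truncated subtraction yields degree 0, where there are no odd monomials.\<close>

lemma card_odd_expo: "card (odd_expo (2 * m - 1)) = m * (m + 1)"
proof (induction m)
  case 0
  have "odd_expo 0 = {}" by (auto simp: odd_expo_def mem_expo)
  then show ?case by simp
next
  case (Suc m)
  have eq: "odd_expo (2 * Suc m - 1) = odd_expo (2 * m - 1) \<union> (\<lambda>i. (i, 2 * m + 1 - i)) ` {..2 * m + 1}"
    (is "_ = _ \<union> ?A")
  proof (intro set_eqI iffI)
    fix e assume e: "e \<in> odd_expo (2 * Suc m - 1)"
    then have "fst e + snd e \<le> 2 * m + 1" "odd (fst e + snd e)"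
      by (auto simp: odd_expo_def mem_expo)
    then have "fst e + snd e = 2 * m + 1 \<or> fst e + snd e \<le> 2 * m - 1"
      by presburger
    then show "e \<in> odd_expo (2 * m - 1) \<union> ?A"
    proof
      assume "fst e + snd e = 2 * m + 1"
      then have "e = (fst e, 2 * m + 1 - fst e)" "fst e \<le> 2 * m + 1" by (auto simp: prod_eq_iff)
      then show ?thesis by blast
    qed (use e in \<open>auto simp: odd_expo_def mem_expo\<close>)
  qed (auto simp: odd_expo_def mem_expo)
  have disj: "odd_expo (2 * m - 1) \<inter> ?A = {}"
    by (auto simp: odd_expo_def mem_expo)
  have fin: "finite (odd_expo (2 * m - 1))" by (auto simp: odd_expo_def)
  have "card ?A = 2 * m + 2" by (subst card_image) (auto simp: inj_on_def)
  then show ?case unfolding eq using fin disj Suc by (simp add: card_Un_disjoint)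
qed

lemma odd_poly2:
  fixes c :: "nat \<times> nat \<Rightarrow> real" and m :: nat
  defines "f \<equiv> \<lambda>z. \<Sum>e\<in>odd_expo m. c e * mon e z"
  shows "f \<in> poly2 m" and "f (- z) = - f z"
proof -
  show "f \<in> poly2 m" unfolding f_def by (rule poly2_sum_mon) (auto simp: odd_expo_def)
  show "f (- z) = - f z" unfolding f_def sum_negf[symmetric]
    by (intro sum.cong refl) (auto simp: mon_uminus odd_expo_def)
qed

text \<open>Each point excludes at most one slope \<open>t\<close>. For \<open>snd z = 0\<close> the
  quotient is 0 by convention, which only excludes a harmless extra value.\<close>

lemma linear_form_nonzero_on_finite:
  assumes "finite (Y :: (real \<times> real) set)"
  obtains t :: real where "\<And>z. z \<in> Y \<Longrightarrow> z \<noteq> 0 \<Longrightarrow> fst z + t * snd z \<noteq> 0"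
proof -
  have "finite ((\<lambda>z. - fst z / snd z) ` Y)" using assms by simp
  then obtain t where t: "t \<notin> (\<lambda>z. - fst z / snd z) ` Y"
    using ex_new_if_finite infinite_UNIV_char_0 by blast
  have "fst z + t * snd z \<noteq> 0" if "z \<in> Y" "z \<noteq> 0" for z
  proof
    assume 0: "fst z + t * snd z = 0"
    show False
    proof (cases "snd z = 0")
      case True with 0 that show False by (simp add: prod_eq_iff)
    next
      case False
      with 0 have "t = - fst z / snd z" by (simp add: field_simps)
      with t that show False by blast
    qed
  qed
  with that show ?thesis by blast
qed

text \<open>
  If the nodes were fewer than twice the number of odd monomials, then some odd \<open>f\<close>, \<open>g\<close> of degree
  at most \<open>2m - 1\<close>, not both 0, would satisfy \<open>f + lg = 0\<close> at all nodes, where \<open>l\<close> is a linear form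
  vanishing at no node except possibly the origin. Since \<open>flg\<close> is odd of degree at most \<open>4m - 1\<close>, this
  gives \<open>L(f\<^sup>2) = - L(flg) = 0\<close>, so \<open>f = 0\<close>; then \<open>g\<close> vanishes at all nodes and \<open>L(g\<^sup>2) = 0\<close>.
\<close>

lemma moeller_bound:
  fixes L :: "(real \<times> real \<Rightarrow> real) \<Rightarrow> real"
  assumes odd: "\<And>f. f \<in> poly2 (4 * m - 1) \<Longrightarrow> (\<And>z. f (- z) = - f z) \<Longrightarrow> L f = 0"
    and pos: "\<And>f. f \<in> poly2 (2 * m - 1) \<Longrightarrow> f \<noteq> (\<lambda>z. 0) \<Longrightarrow> 0 < L (\<lambda>z. (f z)\<^sup>2)"
    and rule: "\<And>f. f \<in> poly2 (4 * m - 1) \<Longrightarrow> L f = (\<Sum>z\<in>Y. \<nu> z * f z)"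
    and fin: "finite Y" and m: "m \<ge> 1"
  shows "2 * m * (m + 1) \<le> card Y"
proof (rule ccontr)
  assume less: "\<not> ?thesis"
  obtain t where t: "\<And>z. z \<in> Y \<Longrightarrow> z \<noteq> 0 \<Longrightarrow> fst z + t * snd z \<noteq> 0"
    using linear_form_nonzero_on_finite[OF fin] by blast
  define l where "l z = fst z + t * snd z" for z :: "real \<times> real"
  have "l = (\<lambda>z. mon (1, 0) z + t * mon (0, 1) z)" by (simp add: fun_eq_iff l_def mon_def)
  then have l1: "l \<in> poly2 1" by (simp add: poly2_add poly2_cmult poly2_mon)
  have lodd: "l (- z) = - l z" for z by (simp add: l_def)
  let ?O = "odd_expo (2 * m - 1)"
  have finO: "finite ?O" by (auto simp: odd_expo_def)
  have "card Y < card (?O <+> ?O)"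
    using less finO card_odd_expo[of m] by (simp add: card_Plus)
  from underdetermined_system[OF fin _ this,
      of "\<lambda>e z. case e of Inl e \<Rightarrow> mon e z | Inr e \<Rightarrow> l z * mon e z"] finO
  obtain c where c: "\<exists>e\<in>?O <+> ?O. c e \<noteq> 0"
    "\<And>z. z \<in> Y \<Longrightarrow> (\<Sum>e\<in>?O <+> ?O. c e * (case e of Inl e \<Rightarrow> mon e z | Inr e \<Rightarrow> l z * mon e z)) = 0"
    by auto
  define f where "f = (\<lambda>z. \<Sum>e\<in>?O. c (Inl e) * mon e z)"
  define g where "g = (\<lambda>z. \<Sum>e\<in>?O. c (Inr e) * mon e z)"
  have fg: "f \<in> poly2 (2 * m - 1)" "g \<in> poly2 (2 * m - 1)" "\<And>z. f (- z) = - f z" "\<And>z. g (- z) = - g z"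
    unfolding f_def g_def by (rule odd_poly2)+
  have on_Y: "f z = - (l z * g z)" if "z \<in> Y" for z
    using c(2)[OF that] finO
    by (simp add: sum.Plus f_def g_def sum_distrib_left mult_ac)
  have "(\<lambda>z. f z * (l z * g z)) \<in> poly2 (2 * m - 1 + (1 + (2 * m - 1)))"
    by (intro poly2_mult fg l1)
  moreover have "2 * m - 1 + (1 + (2 * m - 1)) = 4 * m - 1" using m by simp
  ultimately have flg: "(\<lambda>z. f z * (l z * g z)) \<in> poly2 (4 * m - 1)" by simp
  have sq: "(\<lambda>z. (h z)\<^sup>2) \<in> poly2 (4 * m - 1)" if "h \<in> poly2 (2 * m - 1)" for h
  proof -
    have "2 * m - 1 + (2 * m - 1) \<le> 4 * m - 1" by linarith
    from poly2_mono[OF this] poly2_mult[OF that that] show ?thesis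
      by (auto simp: power2_eq_square)
  qed
  have "L (\<lambda>z. (f z)\<^sup>2) = (\<Sum>z\<in>Y. \<nu> z * (f z)\<^sup>2)" using rule[OF sq[OF fg(1)]] .
  also have "\<dots> = - (\<Sum>z\<in>Y. \<nu> z * (f z * (l z * g z)))"
    unfolding sum_negf[symmetric] using on_Y by (intro sum.cong refl) (simp add: power2_eq_square)
  also have "\<dots> = - L (\<lambda>z. f z * (l z * g z))" using rule[OF flg] by simp
  also have "\<dots> = 0" using odd[OF flg] by (simp add: fg lodd)
  finally have f0: "f = (\<lambda>z. 0)" using pos[OF fg(1)] by fastforce
  \<comment> \<open>At the origin \<open>l\<close> vanishes and gives no information, but there the
    odd function \<open>g\<close> vanishes anyway.\<close>
  have "g z = 0" if "z \<in> Y" for z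
  proof (cases "z = 0")
    case True then show ?thesis using fg(4)[of 0] by simp
  next
    case False then show ?thesis using on_Y[OF that] t[OF that] f0 by (simp add: l_def)
  qed
  then have "L (\<lambda>z. (g z)\<^sup>2) = 0" using rule[OF sq[OF fg(2)]] by simp
  then have g0: "g = (\<lambda>z. 0)" using pos[OF fg(2)] by fastforce
  have "c (Inl e) = 0" "c (Inr e) = 0" if "e \<in> ?O" for e
    using mon_independent[OF finO _ that, of "\<lambda>e. c (Inl e)"]
      mon_independent[OF finO _ that, of "\<lambda>e. c (Inr e)"] f0 g0
    unfolding f_def g_def by meson+
  with c(1) show False by auto
qed

lemma exists_poly2_vanishing:
  assumes "finite X" "card X < dim_poly2 m"
  obtains f where "f \<in> poly2 m" "f \<noteq> (\<lambda>z. 0)" "\<And>z. z \<in> X \<Longrightarrow> f z = 0"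
proof -
  have "card X < card (expo m)" using assms by (simp add: card_expo dim_poly2_eq)
  from underdetermined_system[OF assms(1) finite_expo this, of mon]
  obtain c where c: "\<exists>e\<in>expo m. c e \<noteq> 0" "\<forall>z\<in>X. (\<Sum>e\<in>expo m. c e * mon e z) = 0" by blast
  show ?thesis
  proof
    show "(\<lambda>z. \<Sum>e\<in>expo m. c e * mon e z) \<in> poly2 m" by (rule poly2_sum_mon) simp
    show "(\<lambda>z. \<Sum>e\<in>expo m. c e * mon e z) \<noteq> (\<lambda>z. 0)"
      using c(1) mon_independent[OF finite_expo] by meson
  qed (use c in auto)
qed

section \<open>Hyperbolic substitution\<close>

lemma borel_measurable_cosh [measurable]: "cosh \<in> borel_measurable (borel :: real measure)"
  and borel_measurable_sinh [measurable]: "sinh \<in> borel_measurable (borel :: real measure)"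
  by (intro borel_measurable_continuous_onI continuous_intros)+

text \<open>The substitution rule is available on compact intervals; monotone convergence along
  growing intervals extends it to the half-line. The endpoint \<open>Suc n\<close> keeps every
  interval nondegenerate.\<close>

lemma nn_integral_cosh:
  fixes f :: "real \<Rightarrow> ennreal"
  assumes [measurable]: "f \<in> borel_measurable borel"
  shows "(\<integral>\<^sup>+x. f x * indicator {1..} x \<partial>lborel) =
    (\<integral>\<^sup>+t. f (cosh t) * ennreal (sinh t) * indicator {0..} t \<partial>lborel)"
proof -
  have step: "(\<integral>\<^sup>+x. f x * indicator {1..cosh (real (Suc n))} x \<partial>lborel) =
    (\<integral>\<^sup>+t. f (cosh t) * ennreal (sinh t) * indicator {0..real (Suc n)} t \<partial>lborel)" for n
  proof -
    have "(\<integral>\<^sup>+x. f x * indicator {cosh 0..cosh (real (Suc n))} x \<partial>lborel) =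
      (\<integral>\<^sup>+t. f (cosh t) * ennreal (sinh t) * indicator {0..real (Suc n)} t \<partial>lborel)"
      by (rule nn_integral_substitution_aux)
        (auto intro!: derivative_eq_intros continuous_intros)
    then show ?thesis by simp
  qed
  have sup1: "(SUP n. f x * indicator {1..cosh (real (Suc n))} x) = f x * indicator {1..} x" for x
  proof (rule antisym)
    show "(SUP n. f x * indicator {1..cosh (real (Suc n))} x) \<le> f x * indicator {1..} x"
      by (auto intro!: SUP_least split: split_indicator)
    show "f x * indicator {1..} x \<le> (SUP n. f x * indicator {1..cosh (real (Suc n))} x)"
    proof (cases "1 \<le> x")
      case True
      obtain n where "arcosh x \<le> real n" using real_arch_simple by blast
      then have "x \<le> cosh (real (Suc n))"
        using True cosh_real_nonneg_le_iff[of "arcosh x" "real (Suc n)"]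
        by simp
      then show ?thesis using True by (intro SUP_upper2[of n]) auto
    qed simp
  qed
  have sup2: "(SUP n. f (cosh t) * ennreal (sinh t) * indicator {0..real (Suc n)} t) =
      f (cosh t) * ennreal (sinh t) * indicator {0..} t" for t
  proof (rule antisym)
    show "(SUP n. f (cosh t) * ennreal (sinh t) * indicator {0..real (Suc n)} t) \<le>
        f (cosh t) * ennreal (sinh t) * indicator {0..} t"
      by (auto intro!: SUP_least split: split_indicator)
    show "f (cosh t) * ennreal (sinh t) * indicator {0..} t \<le>
        (SUP n. f (cosh t) * ennreal (sinh t) * indicator {0..real (Suc n)} t)"
    proof (cases "0 \<le> t")
      case True
      obtain n where "t \<le> real n" using real_arch_simple by blast
      then show ?thesis using True by (intro SUP_upper2[of n]) auto
    qed simp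
  qed
  have cosh_mono: "cosh (1 + real m) \<le> cosh (1 + real n)" if "m \<le> n" for m n
    using that by (subst cosh_real_nonneg_le_iff) auto
  have "(\<integral>\<^sup>+x. f x * indicator {1..} x \<partial>lborel) =
      (SUP n. \<integral>\<^sup>+x. f x * indicator {1..cosh (real (Suc n))} x \<partial>lborel)"
    unfolding sup1[symmetric]
    by (rule nn_integral_monotone_convergence_SUP)
      (auto simp: incseq_def le_fun_def split: split_indicator intro: order.trans[OF _ cosh_mono])
  also have "\<dots> = (SUP n. \<integral>\<^sup>+t. f (cosh t) * ennreal (sinh t) * indicator {0..real (Suc n)} t \<partial>lborel)"
    unfolding step ..
  also have "\<dots> = (\<integral>\<^sup>+t. f (cosh t) * ennreal (sinh t) * indicator {0..} t \<partial>lborel)"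
    unfolding sup2[symmetric]
    by (rule nn_integral_monotone_convergence_SUP[symmetric])
      (auto simp: incseq_def le_fun_def split: split_indicator)
  finally show ?thesis .
qed

lemma measurable_Triangle [measurable]: "Triangle \<in> sets borel"
proof -
  have "Triangle = {z \<in> space (borel :: (real \<times> real) measure). 1 < fst z \<and> fst z < snd z}"
    by (auto simp: Triangle_def)
  also have "\<dots> \<in> sets borel" unfolding borel_prod[symmetric] by measurable
  finally show ?thesis .
qed

lemma measurable_Triangle' [measurable]: "Triangle \<in> sets (borel \<Otimes>\<^sub>M borel)"
  unfolding borel_prod by (rule measurable_Triangle)

lemma nn_integral_Triangle_cosh:
  fixes F :: "real \<times> real \<Rightarrow> ennreal"
  assumes F: "F \<in> borel_measurable borel"
  shows "(\<integral>\<^sup>+z. F z * indicator Triangle z \<partial>lborel) =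
    (\<integral>\<^sup>+s. \<integral>\<^sup>+t. F (cosh s, cosh t) * ennreal (sinh s * sinh t) * indicator {(s, t). 0 < s \<and> s < t} (s, t)
       \<partial>lborel \<partial>lborel)"
proof -
  have F2 [measurable]: "F \<in> borel_measurable (borel \<Otimes>\<^sub>M borel)"
    unfolding borel_prod by (rule F)
  have "(\<integral>\<^sup>+z. F z * indicator Triangle z \<partial>lborel) =
      (\<integral>\<^sup>+x. \<integral>\<^sup>+y. F (x, y) * indicator Triangle (x, y) \<partial>lborel \<partial>lborel)"
    unfolding lborel_prod[symmetric] by (subst lborel.nn_integral_fst[symmetric]) measurable
  \<comment> \<open>\<open>Triangle\<close> already forces \<open>y > 1\<close>, so the half-line
    indicator can be inserted to match the substitution lemma.\<close>
  also have "\<dots> = (\<integral>\<^sup>+x. (\<integral>\<^sup>+y. (F (x, y) * indicator Triangle (x, y)) * indicator {1..} y \<partial>lborel) \<partial>lborel)"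
    by (intro nn_integral_cong) (auto simp: Triangle_def split: split_indicator)
  also have "\<dots> = (\<integral>\<^sup>+x. (\<integral>\<^sup>+t. F (x, cosh t) * indicator Triangle (x, cosh t) * ennreal (sinh t)
      * indicator {0..} t \<partial>lborel) \<partial>lborel)"
  proof (rule nn_integral_cong)
    fix x :: real
    have "(\<lambda>y. F (x, y) * indicator Triangle (x, y)) \<in> borel_measurable borel" by measurable
    from nn_integral_cosh[OF this]
    show "(\<integral>\<^sup>+y. (F (x, y) * indicator Triangle (x, y)) * indicator {1..} y \<partial>lborel) =
      (\<integral>\<^sup>+t. F (x, cosh t) * indicator Triangle (x, cosh t) * ennreal (sinh t)
        * indicator {0..} t \<partial>lborel)" .
  qed
  also have "\<dots> = (\<integral>\<^sup>+x. (\<integral>\<^sup>+t. F (x, cosh t) * indicator Triangle (x, cosh t) * ennreal (sinh t)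
      * indicator {0..} t \<partial>lborel) * indicator {1..} x \<partial>lborel)"
    by (intro nn_integral_cong) (auto simp: Triangle_def split: split_indicator)
  also have "\<dots> = (\<integral>\<^sup>+s. (\<integral>\<^sup>+t. F (cosh s, cosh t) * indicator Triangle (cosh s, cosh t) * ennreal (sinh t)
      * indicator {0..} t \<partial>lborel) * ennreal (sinh s) * indicator {0..} s \<partial>lborel)"
    by (rule nn_integral_cosh) measurable
  also have "\<dots> = (\<integral>\<^sup>+s. \<integral>\<^sup>+t. F (cosh s, cosh t) * indicator Triangle (cosh s, cosh t) * ennreal (sinh t)
      * indicator {0..} t * (ennreal (sinh s) * indicator {0..} s) \<partial>lborel \<partial>lborel)"
  proof (rule nn_integral_cong)
    fix s :: real
    have "(\<lambda>t. F (cosh s, cosh t) * indicator Triangle (cosh s, cosh t) * ennreal (sinh t)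
      * indicator {0..} t) \<in> borel_measurable lborel" by measurable
    from nn_integral_multc[OF this]
    show "(\<integral>\<^sup>+t. F (cosh s, cosh t) * indicator Triangle (cosh s, cosh t) * ennreal (sinh t)
      * indicator {0..} t \<partial>lborel) * ennreal (sinh s) * indicator {0..} s =
      (\<integral>\<^sup>+t. F (cosh s, cosh t) * indicator Triangle (cosh s, cosh t) * ennreal (sinh t)
      * indicator {0..} t * (ennreal (sinh s) * indicator {0..} s) \<partial>lborel)"
      by (simp add: mult.assoc)
  qed
  also have "\<dots> = (\<integral>\<^sup>+s. \<integral>\<^sup>+t. F (cosh s, cosh t) * ennreal (sinh s * sinh t)
      * indicator {(s, t). 0 < s \<and> s < t} (s, t) \<partial>lborel \<partial>lborel)"
  proof (intro nn_integral_cong)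
    fix s t :: real
    have "(cosh s, cosh t) \<in> Triangle \<longleftrightarrow> 0 < s \<and> s < t" if "0 \<le> s" "0 \<le> t"
      using that cosh_real_nonneg_less_iff[of 0 s] cosh_real_nonneg_less_iff[of s t]
      by (auto simp: Triangle_def)
    then show "F (cosh s, cosh t) * indicator Triangle (cosh s, cosh t) * ennreal (sinh t)
      * indicator {0..} t * (ennreal (sinh s) * indicator {0..} s) =
      F (cosh s, cosh t) * ennreal (sinh s * sinh t) * indicator {(s, t). 0 < s \<and> s < t} (s, t)"
      by (auto split: split_indicator simp: ennreal_mult mult_ac)
  qed
  finally show ?thesis .
qed

text \<open>A linear change of variables done one coordinate at a time:
  \<open>t = s + \<phi>\<close> for fixed \<open>s\<close>, exchange of the integrals, then
  \<open>s = (\<theta> - \<phi>) / 2\<close> for fixed \<open>\<phi>\<close>. The last substitution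
  produces the factor 1/2.\<close>

lemma nn_integral_shear:
  fixes K :: "real \<times> real \<Rightarrow> ennreal"
  assumes K: "K \<in> borel_measurable borel"
  shows "(\<integral>\<^sup>+s. \<integral>\<^sup>+t. K (s, t) \<partial>lborel \<partial>lborel) =
    (\<integral>\<^sup>+\<phi>. \<integral>\<^sup>+\<theta>. ennreal (1 / 2) * K ((\<theta> - \<phi>) / 2, (\<theta> + \<phi>) / 2) \<partial>lborel \<partial>lborel)"
proof -
  have K2 [measurable]: "K \<in> borel_measurable (borel \<Otimes>\<^sub>M borel)"
    unfolding borel_prod by (rule K)
  have "(\<integral>\<^sup>+s. \<integral>\<^sup>+t. K (s, t) \<partial>lborel \<partial>lborel) = (\<integral>\<^sup>+s. \<integral>\<^sup>+\<phi>. K (s, s + \<phi>) \<partial>lborel \<partial>lborel)"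
  proof (rule nn_integral_cong)
    fix s :: real
    show "(\<integral>\<^sup>+t. K (s, t) \<partial>lborel) = (\<integral>\<^sup>+\<phi>. K (s, s + \<phi>) \<partial>lborel)"
      using nn_integral_real_affine[of "\<lambda>t. K (s, t)" 1 s] by simp
  qed
  also have "\<dots> = (\<integral>\<^sup>+\<phi>. \<integral>\<^sup>+s. K (s, s + \<phi>) \<partial>lborel \<partial>lborel)"
    by (rule lborel_pair.Fubini'[symmetric]) measurable
  also have "\<dots> = (\<integral>\<^sup>+\<phi>. \<integral>\<^sup>+\<theta>. ennreal (1 / 2) * K ((\<theta> - \<phi>) / 2, (\<theta> + \<phi>) / 2) \<partial>lborel \<partial>lborel)"
  proof (rule nn_integral_cong)
    fix \<phi> :: real
    have "(\<integral>\<^sup>+s. K (s, s + \<phi>) \<partial>lborel) =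
        ennreal (1 / 2) * (\<integral>\<^sup>+\<theta>. K (- \<phi> / 2 + 1 / 2 * \<theta>, - \<phi> / 2 + 1 / 2 * \<theta> + \<phi>) \<partial>lborel)"
      using nn_integral_real_affine[of "\<lambda>s. K (s, s + \<phi>)" "1 / 2" "- \<phi> / 2"] by simp
    also have "(\<lambda>\<theta>. K (- \<phi> / 2 + 1 / 2 * \<theta>, - \<phi> / 2 + 1 / 2 * \<theta> + \<phi>)) =
        (\<lambda>\<theta>. K ((\<theta> - \<phi>) / 2, (\<theta> + \<phi>) / 2))"
      by (auto simp: field_simps fun_eq_iff intro!: arg_cong[of _ _ K])
    finally show "(\<integral>\<^sup>+s. K (s, s + \<phi>) \<partial>lborel) =
        (\<integral>\<^sup>+\<theta>. ennreal (1 / 2) * K ((\<theta> - \<phi>) / 2, (\<theta> + \<phi>) / 2) \<partial>lborel)"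
      by (subst nn_integral_cmult) auto
  qed
  finally show ?thesis .
qed


section \<open>The weight on the triangle\<close>

text \<open>
  In hyperbolic coordinates the point with coordinates \<open>cosh \<phi>\<close> and \<open>cosh \<theta>\<close> goes to the point with
  coordinates \<open>cosh ((\<theta> - \<phi>) / 2)\<close> and \<open>cosh ((\<theta> + \<phi>) / 2)\<close>.
\<close>

definition tri_map :: "real \<times> real \<Rightarrow> real \<times> real" where
  "tri_map z = (let p = sqrt ((fst z + 1) * (snd z + 1)); q = sqrt ((fst z - 1) * (snd z - 1))
     in ((p - q) / 2, (p + q) / 2))"

lemma tri_map_measurable [measurable]: "tri_map \<in> borel_measurable borel"
  unfolding tri_map_def Let_def borel_prod[symmetric] by measurable

text \<open>By the half-angle formulas the two square roots are
  \<open>2 * cosh (\<phi> / 2) * cosh (\<theta> / 2)\<close> and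
  \<open>2 * sinh (\<phi> / 2) * sinh (\<theta> / 2)\<close>; nonnegative arguments fix the sign of
  the second. The addition theorem then gives both coordinates.\<close>

lemma tri_map_cosh:
  "tri_map (cosh \<phi>, cosh \<theta>) = (cosh ((\<theta> - \<phi>) / 2), cosh ((\<theta> + \<phi>) / 2))"
  if "0 \<le> \<phi>" "0 \<le> \<theta>"
proof -
  have plus: "cosh (x::real) + 1 = 2 * (cosh (x / 2))\<^sup>2" for x
    using cosh_double_cosh[of "x / 2"] by simp
  have minus: "cosh (x::real) - 1 = 2 * (sinh (x / 2))\<^sup>2" for x
    using cosh_double_cosh[of "x / 2"] by (simp add: sinh_square_eq)
  have "sqrt ((cosh \<phi> + 1) * (cosh \<theta> + 1)) = 2 * (cosh (\<phi> / 2) * cosh (\<theta> / 2))"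
    unfolding plus by (rule real_sqrt_unique) (simp_all add: power2_eq_square)
  moreover have "sqrt ((cosh \<phi> - 1) * (cosh \<theta> - 1)) = 2 * (sinh (\<phi> / 2) * sinh (\<theta> / 2))"
    unfolding minus using that by (intro real_sqrt_unique) (simp_all add: power2_eq_square)
  ultimately show ?thesis
    by (simp add: tri_map_def diff_divide_distrib add_divide_distrib cosh_diff cosh_add mult.commute)
qed

lemma Omega_Triangle:
  assumes "(X, Y) \<in> Triangle" shows "(X + Y, X * Y) \<in> Omega"
proof -
  have "0 < (X - 1) * (Y - 1)" "0 < (Y - X)\<^sup>2" using assms by (auto simp: Triangle_def)
  then show ?thesis using assms
    by (simp add: Omega_def Triangle_def algebra_simps power2_eq_square)
qed

lemma sum_prod_eq_iff:
  fixes a b c d :: real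
  assumes "a + b = c + d" "a * b = c * d"
  shows "a = c \<and> b = d \<or> a = d \<and> b = c"
proof -
  have "b = c + d - a" using assms(1) by simp
  with assms(2) have "(a - c) * (a - d) = 0" by (simp add: algebra_simps)
  with assms(1) show ?thesis by auto
qed

lemma W_weight_sum_prod:
  assumes "(X, Y) \<in> Triangle"
  shows "W_weight w \<gamma> (X + Y, X * Y) = w X * w Y * (Y - X) powr (2 * \<gamma>)"
proof -
  have "(THE z. z \<in> Triangle \<and> fst z + snd z = X + Y \<and> fst z * snd z = X * Y) = (X, Y)"
  proof (rule the_equality)
    fix z assume z: "z \<in> Triangle \<and> fst z + snd z = X + Y \<and> fst z * snd z = X * Y"
    then have "fst z = X \<and> snd z = Y \<or> fst z = Y \<and> snd z = X" by (intro sum_prod_eq_iff) auto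
    with z assms show "z = (X, Y)" by (auto simp: Triangle_def)
  qed (use assms in auto)
  moreover have "\<bar>(X + Y)\<^sup>2 - 4 * (X * Y)\<bar> powr \<gamma> = (Y - X) powr (2 * \<gamma>)"
  proof -
    have "(X + Y)\<^sup>2 - 4 * (X * Y) = (Y - X)\<^sup>2" by (simp add: power2_eq_square algebra_simps)
    moreover have "0 < Y - X" using assms by (simp add: Triangle_def)
    ultimately show ?thesis by (simp add: powr_powr[symmetric] powr_numeral)
  qed
  ultimately show ?thesis using Omega_Triangle[OF assms] by (simp add: W_weight_def)
qed

lemma calW_eq:
  assumes "(X, Y) \<in> Triangle" "2 * x * y = X + Y" "x\<^sup>2 + y\<^sup>2 - 1 = X * Y"
  shows "calW w \<gamma> (x, y) = w X * w Y * (Y - X) powr (2 * \<gamma>) * \<bar>x\<^sup>2 - y\<^sup>2\<bar>"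
  by (simp add: calW_def assms(2,3) W_weight_sum_prod[OF assms(1)])

text \<open>The wanted pair consists of the roots of the quadratic
  \<open>Z\<^sup>2 - 2xyZ + (x\<^sup>2 + y\<^sup>2 - 1)\<close>; a quarter of its discriminant
  factors as \<open>(x\<^sup>2 - 1) * (y\<^sup>2 - 1)\<close>, whence \<open>r\<close>.\<close>

lemma Triangle_inverse:
  assumes "(x, y) \<in> Triangle"
  defines "r \<equiv> sqrt ((x\<^sup>2 - 1) * (y\<^sup>2 - 1))"
  shows "(x * y - r, x * y + r) \<in> Triangle"
    and "2 * x * y = (x * y - r) + (x * y + r)"
    and "x\<^sup>2 + y\<^sup>2 - 1 = (x * y - r) * (x * y + r)"
proof -
  have xy: "1 < x" "x < y" using assms by (auto simp: Triangle_def)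
  have pos: "0 < (x\<^sup>2 - 1) * (y\<^sup>2 - 1)" using xy by (intro mult_pos_pos) (auto simp: one_less_power)
  have xy1: "1 < x * y" using xy by (simp add: less_1_mult)
  have "(x\<^sup>2 - 1) * (y\<^sup>2 - 1) = (x * y - 1)\<^sup>2 - (y - x)\<^sup>2" by (simp add: power2_eq_square algebra_simps)
  also have "\<dots> < (x * y - 1)\<^sup>2" using xy by simp
  finally have "r < x * y - 1" unfolding r_def using xy1 by (intro real_less_lsqrt) auto
  moreover have "0 < r" unfolding r_def using pos by simp
  ultimately show "(x * y - r, x * y + r) \<in> Triangle" by (simp add: Triangle_def)
  show "2 * x * y = (x * y - r) + (x * y + r)" by simp
  have "r\<^sup>2 = (x\<^sup>2 - 1) * (y\<^sup>2 - 1)" unfolding r_def using pos by simp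
  then show "x\<^sup>2 + y\<^sup>2 - 1 = (x * y - r) * (x * y + r)"
    by (simp add: power2_eq_square algebra_simps)
qed

locale triangle_weight =
  fixes w :: "real \<Rightarrow> real" and \<gamma> :: real and e :: nat
  assumes weight: "weight_fun w" and exponent: "2 * \<gamma> + 1 = real e"
begin

text \<open>Cutting off at 1 gives a function that is nonnegative and Borel on the whole line;
  \<open>w\<close> itself is constrained only on the half-line.\<close>

definition wt :: "real \<Rightarrow> real" where
  "wt t = indicator {1..} t * w t"

definition tri_dens :: "real \<times> real \<Rightarrow> real" where
  "tri_dens z = indicator Triangle z * (wt (fst z) * wt (snd z) * (snd z - fst z) ^ e)"

text \<open>The part of the weight on one fundamental domain of the group generated by swapping the
  coordinates and negating the point.\<close>

definition calV :: "real \<times> real \<Rightarrow> real" where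
  "calV z = indicator Triangle z * calW w \<gamma> z"

lemma wt_nonneg [simp]: "0 \<le> wt t"
  using weight by (auto simp: wt_def weight_fun_def split: split_indicator)

lemma wt_moment: "integrable lborel (\<lambda>t. t ^ k * wt t)"
proof -
  have "set_integrable lborel {1..} (\<lambda>t. t ^ k * w t)" using weight by (simp add: weight_fun_def)
  then show ?thesis by (simp add: set_integrable_def wt_def mult_ac)
qed

lemma wt_measurable [measurable]: "wt \<in> borel_measurable borel"
  using wt_moment[of 0] by (simp add: integrable_iff_bounded)

lemma tri_dens_nonneg [simp]: "0 \<le> tri_dens z"
  by (auto simp: tri_dens_def Triangle_def split: split_indicator intro!: mult_nonneg_nonneg)

lemma tri_dens_measurable [measurable]: "tri_dens \<in> borel_measurable borel"
proof -
  show ?thesis unfolding tri_dens_def borel_prod[symmetric] by measurable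
qed

text \<open>An explicit formula in place of the definite description inside \<open>W_weight\<close>;
  nonnegativity and measurability are read off from it.\<close>

lemma calV_eq:
  "calV (x, y) = indicator Triangle (x, y) *
     (let r = sqrt ((x\<^sup>2 - 1) * (y\<^sup>2 - 1))
      in wt (x * y - r) * wt (x * y + r) * (2 * r) powr (2 * \<gamma>) * (y\<^sup>2 - x\<^sup>2))"
proof (cases "(x, y) \<in> Triangle")
  case True
  define r where "r = sqrt ((x\<^sup>2 - 1) * (y\<^sup>2 - 1))"
  have tri: "(x * y - r, x * y + r) \<in> Triangle"
    unfolding r_def by (rule Triangle_inverse(1)[OF True])
  have "\<bar>x\<^sup>2 - y\<^sup>2\<bar> = y\<^sup>2 - x\<^sup>2"
    using True by (auto simp: Triangle_def)
  moreover have "x * y + r - (x * y - r) = 2 * r" by simp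
  ultimately have "calW w \<gamma> (x, y) = w (x * y - r) * w (x * y + r) * (2 * r) powr (2 * \<gamma>) * (y\<^sup>2 - x\<^sup>2)"
    using calW_eq[OF tri Triangle_inverse(2,3)[OF True, folded r_def], of w \<gamma>] by metis
  moreover have "wt (x * y - r) = w (x * y - r)" "wt (x * y + r) = w (x * y + r)"
    using tri by (auto simp: wt_def Triangle_def)
  ultimately show ?thesis using True by (simp add: calV_def Let_def r_def)
qed (simp add: calV_def)

lemma calV_nonneg [simp]: "0 \<le> calV z"
proof (cases z)
  case (Pair x y)
  have "x\<^sup>2 \<le> y\<^sup>2" if "(x, y) \<in> Triangle" using that by (auto simp: Triangle_def)
  then show ?thesis unfolding Pair calV_eq Let_def
    by (auto split: split_indicator intro!: mult_nonneg_nonneg)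
qed

lemma calV_measurable [measurable]: "calV \<in> borel_measurable borel"
proof -
  have "calV = (\<lambda>z. indicator Triangle z *
     (let r = sqrt (((fst z)\<^sup>2 - 1) * ((snd z)\<^sup>2 - 1))
      in wt (fst z * snd z - r) * wt (fst z * snd z + r) * (2 * r) powr (2 * \<gamma>) * ((snd z)\<^sup>2 - (fst z)\<^sup>2)))"
    using calV_eq by (auto simp: fun_eq_iff)
  also have "\<dots> \<in> borel_measurable borel"
    unfolding Let_def borel_prod[symmetric] by measurable
  finally show ?thesis .
qed

text \<open>The integrands of the two hyperbolic substitutions agree. With
  \<open>X = cosh \<phi>\<close> and \<open>Y = cosh \<theta>\<close> one has
  \<open>Y - X = 2 * sinh a * sinh b\<close>, which turns the surface factor on the left into the
  extra power of \<open>Y - X\<close>, and \<open>\<bar>x\<^sup>2 - y\<^sup>2\<bar> = sinh \<phi> *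
  sinh \<theta>\<close>, which is the surface factor on the right. The 1/2 on the left comes from
  the shear.\<close>

lemma jacobian:
  assumes "0 < \<phi>" "\<phi> < \<theta>"
  defines "a \<equiv> (\<theta> - \<phi>) / 2" and "b \<equiv> (\<theta> + \<phi>) / 2"
  shows "1 / 2 * (calV (cosh a, cosh b) * (sinh a * sinh b)) =
    1 / 4 * (tri_dens (cosh \<phi>, cosh \<theta>) * (sinh \<phi> * sinh \<theta>))"
proof -
  have ab: "0 < a" "a < b" "\<theta> = b + a" "\<phi> = b - a" using assms by (auto simp: a_def b_def field_simps)
  have tri: "(cosh a, cosh b) \<in> Triangle" "(cosh \<phi>, cosh \<theta>) \<in> Triangle"
    using cosh_real_strict_mono[of 0 a] cosh_real_strict_mono[of a b]
      cosh_real_strict_mono[of 0 \<phi>] cosh_real_strict_mono[of \<phi> \<theta>] ab(1,2) assms(1,2)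
    unfolding Triangle_def mem_Collect_eq case_prod_conv cosh_0 by linarith+
  have sum: "2 * cosh a * cosh b = cosh \<phi> + cosh \<theta>"
    by (simp add: ab(3,4) cosh_add cosh_diff)
  have prod: "(cosh a)\<^sup>2 + (cosh b)\<^sup>2 - 1 = cosh \<phi> * cosh \<theta>"
  proof -
    have "cosh \<phi> * cosh \<theta> = (cosh b)\<^sup>2 * (cosh a)\<^sup>2 - (sinh b)\<^sup>2 * (sinh a)\<^sup>2"
      by (simp add: ab(3,4) cosh_add cosh_diff power2_eq_square algebra_simps)
    also have "\<dots> = (cosh a)\<^sup>2 + (cosh b)\<^sup>2 - 1"
      by (simp add: sinh_square_eq algebra_simps)
    finally show ?thesis by simp
  qed
  have diff: "cosh \<theta> - cosh \<phi> = 2 * (sinh a * sinh b)"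
    by (simp add: ab(3,4) cosh_add cosh_diff)
  have sq: "(cosh b)\<^sup>2 - (cosh a)\<^sup>2 = sinh \<phi> * sinh \<theta>"
  proof -
    have "sinh \<phi> * sinh \<theta> = (sinh b)\<^sup>2 * (cosh a)\<^sup>2 - (cosh b)\<^sup>2 * (sinh a)\<^sup>2"
      by (simp add: ab(3,4) sinh_add sinh_diff power2_eq_square algebra_simps)
    also have "\<dots> = (cosh b)\<^sup>2 - (cosh a)\<^sup>2"
      by (simp add: sinh_square_eq algebra_simps)
    finally show ?thesis by simp
  qed
  have pos: "0 < cosh \<theta> - cosh \<phi>" using tri by (simp add: Triangle_def)
  have "\<bar>(cosh a)\<^sup>2 - (cosh b)\<^sup>2\<bar> = sinh \<phi> * sinh \<theta>"
  proof -
    have "0 \<le> sinh \<phi> * sinh \<theta>" using assms by simp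
    then show ?thesis unfolding sq[symmetric] by simp
  qed
  then have "calV (cosh a, cosh b) = wt (cosh \<phi>) * wt (cosh \<theta>)
      * (cosh \<theta> - cosh \<phi>) powr (2 * \<gamma>) * (sinh \<phi> * sinh \<theta>)"
    using tri calW_eq[OF tri(2) sum prod] by (simp add: calV_def wt_def Triangle_def)
  moreover have "(cosh \<theta> - cosh \<phi>) ^ e = (cosh \<theta> - cosh \<phi>) powr (2 * \<gamma>) * (cosh \<theta> - cosh \<phi>)"
    unfolding powr_realpow[OF pos, symmetric] exponent[symmetric] powr_add using pos by simp
  ultimately show ?thesis using tri
    by (simp add: tri_dens_def diff mult_ac)
qed

text \<open>On each Borel set both measures are brought to the same iterated integral in
  \<open>\<phi>\<close> and \<open>\<theta>\<close>: the left one by the \<open>cosh\<close>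
  substitution and the shear, the right one by the \<open>cosh\<close> substitution alone.\<close>

lemma density_calV:
  "density lborel calV = distr (density lborel (\<lambda>z. tri_dens z / 4)) borel tri_map"
proof (rule measure_eqI)
  show "sets (density lborel calV) = sets (distr (density lborel (\<lambda>z. tri_dens z / 4)) borel tri_map)"
    by simp
next
  fix B assume "B \<in> sets (density lborel calV)"
  then have B [measurable]: "B \<in> sets borel" by simp
  have "emeasure (density lborel calV) B = (\<integral>\<^sup>+z. ennreal (calV z) * indicator B z \<partial>lborel)"
    by (subst emeasure_density) auto
  also have "\<dots> = (\<integral>\<^sup>+z. ennreal (calV z) * indicator B z * indicator Triangle z \<partial>lborel)"
    by (intro nn_integral_cong) (auto simp: calV_def split: split_indicator)
  also have "\<dots> = (\<integral>\<^sup>+s. \<integral>\<^sup>+t. ennreal (calV (cosh s, cosh t)) * indicator B (cosh s, cosh t)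
      * ennreal (sinh s * sinh t) * indicator {(s, t). 0 < s \<and> s < t} (s, t) \<partial>lborel \<partial>lborel)"
    by (subst nn_integral_Triangle_cosh) auto
  also have "\<dots> = (\<integral>\<^sup>+\<phi>. \<integral>\<^sup>+\<theta>. ennreal (1 / 2) *
      (ennreal (calV (cosh ((\<theta> - \<phi>) / 2), cosh ((\<theta> + \<phi>) / 2)))
       * indicator B (cosh ((\<theta> - \<phi>) / 2), cosh ((\<theta> + \<phi>) / 2))
       * ennreal (sinh ((\<theta> - \<phi>) / 2) * sinh ((\<theta> + \<phi>) / 2))
       * indicator {(s, t). 0 < s \<and> s < t} ((\<theta> - \<phi>) / 2, (\<theta> + \<phi>) / 2)) \<partial>lborel \<partial>lborel)"
  proof -
    have [measurable]: "calV \<in> borel_measurable (borel \<Otimes>\<^sub>M borel)" "B \<in> sets (borel \<Otimes>\<^sub>M borel)"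
      unfolding borel_prod by (rule calV_measurable, rule B)
    have "{(s, t). 0 < s \<and> s < (t::real)} = {z \<in> space (borel \<Otimes>\<^sub>M borel). 0 < fst z \<and> fst z < snd z}"
      by (auto simp: space_pair_measure)
    also have "\<dots> \<in> sets (borel \<Otimes>\<^sub>M borel)" by measurable
    finally have [measurable]: "{(s, t). 0 < s \<and> s < (t::real)} \<in> sets (borel \<Otimes>\<^sub>M borel)" .
    have "(\<lambda>z. ennreal (calV (cosh (fst z), cosh (snd z))) * indicator B (cosh (fst z), cosh (snd z))
      * ennreal (sinh (fst z) * sinh (snd z)) * indicator {(s, t). 0 < s \<and> s < t} (fst z, snd z))
      \<in> borel_measurable borel"
      unfolding borel_prod[symmetric] by measurable
    from nn_integral_shear[OF this] show ?thesis by simp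
  qed
  also have "\<dots> = (\<integral>\<^sup>+\<phi>. \<integral>\<^sup>+\<theta>. (ennreal (tri_dens (cosh \<phi>, cosh \<theta>) / 4) * indicator B (tri_map (cosh \<phi>, cosh \<theta>)))
      * ennreal (sinh \<phi> * sinh \<theta>) * indicator {(s, t). 0 < s \<and> s < t} (\<phi>, \<theta>) \<partial>lborel \<partial>lborel)"
  proof (intro nn_integral_cong)
    fix \<phi> \<theta> :: real
    let ?a = "(\<theta> - \<phi>) / 2" and ?b = "(\<theta> + \<phi>) / 2"
    \<comment> \<open>The shear maps the wedge \<open>0 < \<phi> < \<theta>\<close> onto the wedge
      of the same shape in the half-sum coordinates.\<close>
    have iff: "0 < ?a \<and> ?a < ?b \<longleftrightarrow> 0 < \<phi> \<and> \<phi> < \<theta>" by auto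
    show "ennreal (1 / 2) * (ennreal (calV (cosh ?a, cosh ?b)) * indicator B (cosh ?a, cosh ?b)
       * ennreal (sinh ?a * sinh ?b) * indicator {(s, t). 0 < s \<and> s < t} (?a, ?b)) =
      (ennreal (tri_dens (cosh \<phi>, cosh \<theta>) / 4) * indicator B (tri_map (cosh \<phi>, cosh \<theta>)))
      * ennreal (sinh \<phi> * sinh \<theta>) * indicator {(s, t). 0 < s \<and> s < t} (\<phi>, \<theta>)"
    proof (cases "0 < \<phi> \<and> \<phi> < \<theta>")
      case True
      have "ennreal (1 / 2) * (ennreal (calV (cosh ?a, cosh ?b)) * ennreal (sinh ?a * sinh ?b)) =
          ennreal (1 / 2 * (calV (cosh ?a, cosh ?b) * (sinh ?a * sinh ?b)))"
        using True by (subst ennreal_mult, simp, simp)+ simp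
      also have "\<dots> = ennreal (1 / 4 * (tri_dens (cosh \<phi>, cosh \<theta>) * (sinh \<phi> * sinh \<theta>)))"
        using jacobian[of \<phi> \<theta>] True by (simp only:)
      also have "\<dots> = ennreal (tri_dens (cosh \<phi>, cosh \<theta>) / 4) * ennreal (sinh \<phi> * sinh \<theta>)"
        using True by (simp add: ennreal_mult[symmetric])
      finally show ?thesis using True tri_map_cosh[of \<phi> \<theta>] iff
        by (auto simp: mult_ac split: split_indicator)
    next
      case False
      then show ?thesis using iff by simp
    qed
  qed
  also have "\<dots> = (\<integral>\<^sup>+z. ennreal (tri_dens z / 4) * indicator B (tri_map z) * indicator Triangle z \<partial>lborel)"
    by (subst nn_integral_Triangle_cosh) auto
  also have "\<dots> = (\<integral>\<^sup>+z. ennreal (tri_dens z / 4) * indicator (tri_map -` B) z \<partial>lborel)"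
    by (intro nn_integral_cong) (auto simp: tri_dens_def split: split_indicator)
  also have "\<dots> = emeasure (density lborel (\<lambda>z. tri_dens z / 4)) (tri_map -` B)"
    using measurable_sets[OF tri_map_measurable B] by (subst emeasure_density) auto
  also have "\<dots> = emeasure (distr (density lborel (\<lambda>z. tri_dens z / 4)) borel tri_map) B"
    by (subst emeasure_distr) auto
  finally show "emeasure (density lborel calV) B =
      emeasure (distr (density lborel (\<lambda>z. tri_dens z / 4)) borel tri_map) B" .
qed

lemma integrable_calV_iff:
  assumes [measurable]: "f \<in> borel_measurable borel"
  shows "integrable lborel (\<lambda>z. f z * calV z) \<longleftrightarrow> integrable lborel (\<lambda>z. f (tri_map z) * tri_dens z)"
    and "(LINT z|lborel. f z * calV z) = (LINT z|lborel. f (tri_map z) * tri_dens z) / 4"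
proof -
  have "integrable lborel (\<lambda>z. f z * calV z) \<longleftrightarrow> integrable (density lborel calV) f"
    by (subst integrable_density) (auto simp: mult.commute)
  also have "\<dots> \<longleftrightarrow> integrable (density lborel (\<lambda>z. tri_dens z / 4)) (\<lambda>z. f (tri_map z))"
    unfolding density_calV by (subst integrable_distr_eq) auto
  also have "\<dots> \<longleftrightarrow> integrable lborel (\<lambda>z. f (tri_map z) * tri_dens z)"
    using integrable_mult_right_iff[of lborel "\<lambda>z. f (tri_map z) * tri_dens z" "1 / 4"]
    by (subst integrable_density) (auto simp: mult.commute)
  finally show "integrable lborel (\<lambda>z. f z * calV z) \<longleftrightarrow> integrable lborel (\<lambda>z. f (tri_map z) * tri_dens z)" .
  have "(LINT z|lborel. f z * calV z) = (LINT z|density lborel calV. f z)"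
    by (subst integral_density) (auto simp: mult.commute)
  also have "\<dots> = (LINT z|density lborel (\<lambda>z. tri_dens z / 4). f (tri_map z))"
    unfolding density_calV by (subst integral_distr) auto
  also have "\<dots> = (LINT z|lborel. f (tri_map z) * tri_dens z) / 4"
    by (subst integral_density) (auto simp: mult.commute)
  finally show "(LINT z|lborel. f z * calV z) = (LINT z|lborel. f (tri_map z) * tri_dens z) / 4" .
qed

end

section \<open>Integrals over the whole domain\<close>

lemma lborel_distr_swap: "distr lborel borel prod.swap = (lborel :: (real \<times> real) measure)"
proof -
  have "lborel = distr lborel (lborel :: (real \<times> real) measure) (\<lambda>(x, y). (y, x))"
    using lborel_pair.distr_pair_swap[where 'a = real and 'b = real] by (simp only: lborel_prod)
  also have "\<dots> = distr lborel borel prod.swap"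
    by (rule distr_cong) auto
  finally show ?thesis ..
qed

lemma lborel_distr_minus: "distr lborel borel uminus = (lborel :: (real \<times> real) measure)"
  using lborel_affine[of "- 1" "0 :: real \<times> real"] by (simp add: density_1)

lemma swap_measurable [measurable]: "prod.swap \<in> borel_measurable (borel :: (real \<times> real) measure)"
  and minus_measurable: "uminus \<in> borel_measurable (borel :: (real \<times> real) measure)"
  by (intro borel_measurable_continuous_onI continuous_on_swap continuous_intros)+

lemma lborel_distr_minus_swap:
  "distr lborel borel (\<lambda>z. - prod.swap z) = (lborel :: (real \<times> real) measure)"
proof -
  have "distr (distr lborel borel prod.swap) borel uminus =
      distr lborel borel (uminus \<circ> (prod.swap :: real \<times> real \<Rightarrow> _))"
    by (rule distr_distr) auto
  then show ?thesis by (simp add: lborel_distr_swap lborel_distr_minus comp_def)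
qed

lemma preserving_integral:
  fixes h :: "real \<times> real \<Rightarrow> real"
  assumes "distr lborel borel \<sigma> = lborel" and [measurable]: "\<sigma> \<in> borel_measurable borel" "h \<in> borel_measurable borel"
  shows "integrable lborel (\<lambda>z. h (\<sigma> z)) \<longleftrightarrow> integrable lborel h"
    and "(LINT z|lborel. h (\<sigma> z)) = (LINT z|lborel. h z)"
  using integrable_distr_eq[of \<sigma> lborel borel h] integral_distr[of \<sigma> lborel borel h] assms by simp_all

lemma poly2_swap: "f \<in> poly2 m \<Longrightarrow> (\<lambda>z. f (prod.swap z)) \<in> poly2 m"
proof -
  assume "f \<in> poly2 m"
  then obtain c where f: "f = (\<lambda>z. \<Sum>e\<in>expo m. c e * mon e z)" unfolding poly2_eq by auto
  have "mon e (prod.swap z) = mon (prod.swap e) z" for e z by (simp add: mon_def mult.commute)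
  then show ?thesis unfolding f
    by (auto intro!: poly2_sum poly2_cmult poly2_mon simp: mem_expo add.commute)
qed

lemma poly2_minus: "f \<in> poly2 m \<Longrightarrow> (\<lambda>z. f (- z)) \<in> poly2 m"
proof -
  assume "f \<in> poly2 m"
  then obtain c where f: "f = (\<lambda>z. \<Sum>e\<in>expo m. c e * mon e z)" unfolding poly2_eq by auto
  show ?thesis unfolding f mon_uminus
    by (auto intro!: poly2_sum poly2_cmult poly2_mon simp: mem_expo)
qed

lemma tri_map_props:
  assumes "1 \<le> X" "1 \<le> Y" and xy: "tri_map (X, Y) = (x, y)"
  shows "2 * x * y = X + Y" "x\<^sup>2 + y\<^sup>2 - 1 = X * Y" "1 \<le> x" "1 \<le> y"
proof -
  define p where "p = sqrt ((X + 1) * (Y + 1))"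
  define q where "q = sqrt ((X - 1) * (Y - 1))"
  have x: "x = (p - q) / 2" and y: "y = (p + q) / 2"
    using xy by (auto simp: tri_map_def p_def q_def Let_def)
  have p2: "p\<^sup>2 = (X + 1) * (Y + 1)" and q2: "q\<^sup>2 = (X - 1) * (Y - 1)"
    using assms by (simp_all add: p_def q_def)
  have "2 * x * y = (p\<^sup>2 - q\<^sup>2) / 2" by (simp add: x y power2_eq_square field_simps)
  then show "2 * x * y = X + Y" unfolding p2 q2 by (simp add: field_simps)
  have "x\<^sup>2 + y\<^sup>2 = (p\<^sup>2 + q\<^sup>2) / 2" by (simp add: x y power2_eq_square field_simps)
  then show "x\<^sup>2 + y\<^sup>2 - 1 = X * Y" unfolding p2 q2 by (simp add: field_simps)
  have "tri_map (X, Y) = (cosh ((arcosh Y - arcosh X) / 2), cosh ((arcosh Y + arcosh X) / 2))"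
    using tri_map_cosh[of "arcosh X" "arcosh Y"] assms by simp
  then show "1 \<le> x" "1 \<le> y" using xy cosh_real_ge_1 by auto
qed

text \<open>Bounding by a power of the product is useful because \<open>xy = (X + Y) / 2\<close> is
  at most the larger of \<open>X\<close> and \<open>Y\<close>.\<close>

lemma mon_bound:
  fixes x y :: real
  assumes "1 \<le> x" "1 \<le> y"
  shows "x ^ i * y ^ j \<le> (x * y) ^ (i + j)"
proof -
  have "x ^ i * y ^ j \<le> x ^ (i + j) * y ^ (i + j)"
    using assms by (intro mult_mono power_increasing) auto
  then show ?thesis by (simp add: power_mult_distrib)
qed

lemma
  fixes f g :: "real \<Rightarrow> real"
  assumes f: "integrable lborel f" and g: "integrable lborel g"
  shows integrable_lborel_mult: "integrable lborel (\<lambda>z. f (fst z) * g (snd z))"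
    and integral_lborel_mult:
      "(LINT z|lborel. f (fst z) * g (snd z)) = (LINT x|lborel. f x) * (LINT y|lborel. g y)"
proof -
  have [measurable]: "f \<in> borel_measurable borel" "g \<in> borel_measurable borel"
    using f g by (auto simp: integrable_iff_bounded)
  have int: "integrable (lborel \<Otimes>\<^sub>M lborel) (\<lambda>z. f (fst z) * g (snd z))"
  proof (rule lborel_pair.Fubini_integrable)
    have "integrable lborel (\<lambda>x. norm (f x) * (LINT y|lborel. norm (g y)))"
      using f by (intro integrable_mult_left integrable_norm) auto
    then show "integrable lborel (\<lambda>x. LINT y|lborel. norm (f (fst (x, y)) * g (snd (x, y))))"
      by (simp add: abs_mult)
  qed (use g in auto)
  then show "integrable lborel (\<lambda>z. f (fst z) * g (snd z))" by (simp add: lborel_prod)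
  have "(LINT z|lborel. f (fst z) * g (snd z)) = (LINT x|lborel. LINT y|lborel. f x * g y)"
    using lborel_pair.integral_fst'[OF int] by (simp add: lborel_prod)
  then show "(LINT z|lborel. f (fst z) * g (snd z)) = (LINT x|lborel. f x) * (LINT y|lborel. g y)"
    by simp
qed

context triangle_weight
begin

lemma calW_swap: "calW w \<gamma> (prod.swap z) = calW w \<gamma> z"
proof (cases z)
  case (Pair x y)
  have "W_weight w \<gamma> (2 * y * x, y\<^sup>2 + x\<^sup>2 - 1) = W_weight w \<gamma> (2 * x * y, x\<^sup>2 + y\<^sup>2 - 1)"
    by (simp only: mult.assoc mult.commute[of y x] add.commute[of "y\<^sup>2"])
  then show ?thesis by (simp add: Pair calW_def abs_minus_commute)
qed

lemma calW_minus: "calW w \<gamma> (- z) = calW w \<gamma> z"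
  by (cases z) (simp add: calW_def)

text \<open>Where the weight is nonzero, membership in \<open>Omega\<close> says that
  \<open>xy > 1\<close>, \<open>(x - y)\<^sup>2 > 0\<close> and
  \<open>(x\<^sup>2 - 1) * (y\<^sup>2 - 1) > 0\<close>. These force the point into exactly one of
  the four open images of \<open>Triangle\<close>, so exactly one summand survives. Elsewhere all
  terms are 0, hence the identity holds pointwise.\<close>

lemma calW_G_dom:
  "indicator G_dom z * calW w \<gamma> z =
     calV z + calV (prod.swap z) + calV (- z) + calV (- prod.swap z)"
proof (cases "calW w \<gamma> z = 0")
  case True
  then show ?thesis by (simp add: calV_def calW_swap calW_minus)
next
  case False
  obtain x y where z: "z = (x, y)" by (cases z)
  from False have Om: "(2 * x * y, x\<^sup>2 + y\<^sup>2 - 1) \<in> Omega"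
    unfolding z calW_def W_weight_def by (auto split: if_splits)
  then have "1 < x * y" and ne: "0 < (x - y)\<^sup>2" and pos: "0 < (x\<^sup>2 - 1) * (y\<^sup>2 - 1)"
    by (simp_all add: Omega_def power2_eq_square algebra_simps)
  have "x\<^sup>2 > 1 \<and> y\<^sup>2 > 1"
  proof (rule ccontr)
    assume "\<not> ?thesis"
    with pos have "x\<^sup>2 < 1" "y\<^sup>2 < 1" by (auto simp: zero_less_mult_iff)
    then have "x\<^sup>2 * y\<^sup>2 \<le> 1" by (intro mult_le_one) auto
    moreover have "1 < (x * y)\<^sup>2" using \<open>1 < x * y\<close> by (simp add: one_less_power)
    ultimately show False by (simp add: power_mult_distrib)
  qed
  then have "1 < \<bar>x\<bar>" "1 < \<bar>y\<bar>"
    using power_mono[of "\<bar>x\<bar>" 1 2] power_mono[of "\<bar>y\<bar>" 1 2] by force+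
  moreover have "0 < x \<longleftrightarrow> 0 < y"
  proof -
    have "0 < x * y" using \<open>1 < x * y\<close> by simp
    then show ?thesis by (auto simp: zero_less_mult_iff)
  qed
  moreover have "x \<noteq> y" using ne by auto
  ultimately consider "1 < x" "x < y" | "1 < y" "y < x" | "1 < - x" "- x < - y" | "1 < - y" "- y < - x"
    by linarith
  then show ?thesis
    by cases (auto simp: z calV_def G_dom_def Triangle_def calW_swap[of "(x, y)", simplified]
        calW_minus[of "(x, y)", simplified] calW_minus[of "(y, x)", simplified])
qed

lemma integral_G_dom:
  assumes f: "f \<in> poly2 d" and int: "\<And>g. g \<in> poly2 d \<Longrightarrow> integrable lborel (\<lambda>z. g z * calV z)"
  shows "set_integrable lborel G_dom (\<lambda>z. f z * calW w \<gamma> z)"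
    and "integral_against (calW w \<gamma>) G_dom f = (LINT z|lborel. orbit_sum f (fst z) (snd z) * calV z)"
proof -
  note [measurable] = borel_measurable_poly2[OF f] minus_measurable
  have eq: "indicator G_dom z *\<^sub>R (f z * calW w \<gamma> z) =
      f z * calV z + f z * calV (prod.swap z) + f z * calV (- z) + f z * calV (- prod.swap z)" for z
  proof -
    have "indicator G_dom z *\<^sub>R (f z * calW w \<gamma> z) = f z * (indicator G_dom z * calW w \<gamma> z)"
      by simp
    also have "\<dots> = f z * calV z + f z * calV (prod.swap z) + f z * calV (- z) + f z * calV (- prod.swap z)"
      unfolding calW_G_dom distrib_left ..
    finally show ?thesis .
  qed
  \<comment> \<open>A measure-preserving involution can be moved from the weight to the polynomial;
    the three nontrivial symmetries are all of this kind.\<close>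
  have transform: "integrable lborel (\<lambda>z. f z * calV (\<sigma> z))"
    "(LINT z|lborel. f z * calV (\<sigma> z)) = (LINT z|lborel. f (\<sigma> z) * calV z)"
    if "(\<lambda>z. f (\<sigma> z)) \<in> poly2 d" "distr lborel borel \<sigma> = lborel" "\<And>z. \<sigma> (\<sigma> z) = z"
      and [measurable]: "\<sigma> \<in> borel_measurable borel" for \<sigma>
  proof -
    have m: "(\<lambda>z. f (\<sigma> z) * calV z) \<in> borel_measurable borel" by measurable
    have "integrable lborel (\<lambda>z. f (\<sigma> (\<sigma> z)) * calV (\<sigma> z))"
      using preserving_integral(1)[OF that(2,4) m] int[OF that(1)] by simp
    then show "integrable lborel (\<lambda>z. f z * calV (\<sigma> z))" by (simp add: that)
    show "(LINT z|lborel. f z * calV (\<sigma> z)) = (LINT z|lborel. f (\<sigma> z) * calV z)"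
      using preserving_integral(2)[OF that(2,4) m] by (simp add: that)
  qed
  have minus_swap: "(\<lambda>z. f (- prod.swap z)) \<in> poly2 d"
    using poly2_swap[OF poly2_minus[OF f]] by simp
  have ms [measurable]: "(\<lambda>z. - prod.swap z) \<in> borel_measurable (borel :: (real \<times> real) measure)"
    by measurable
  note 1 = transform[OF poly2_swap[OF f] lborel_distr_swap swap_swap swap_measurable]
  note 2 = transform[OF poly2_minus[OF f] lborel_distr_minus minus_minus minus_measurable]
  have inv: "- prod.swap (- prod.swap z) = z" for z :: "real \<times> real" by (cases z) simp
  note 3 = transform[OF minus_swap lborel_distr_minus_swap inv ms]
  show "set_integrable lborel G_dom (\<lambda>z. f z * calW w \<gamma> z)"
    unfolding set_integrable_def eq using 1 2 3 int[OF f] by (intro Bochner_Integration.integrable_add)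
  have "integral_against (calW w \<gamma>) G_dom f = (LINT z|lborel. f z * calV z)
      + (LINT z|lborel. f (prod.swap z) * calV z) + (LINT z|lborel. f (- z) * calV z)
      + (LINT z|lborel. f (- prod.swap z) * calV z)"
    unfolding integral_against_def set_lebesgue_integral_def eq
    using 1 2 3 int[OF f] by simp
  also have "\<dots> = (LINT z|lborel. f z * calV z + f (prod.swap z) * calV z + f (- z) * calV z
      + f (- prod.swap z) * calV z)"
    using int[OF f] int[OF poly2_swap[OF f]] int[OF poly2_minus[OF f]] int[OF minus_swap] by simp
  also have "\<dots> = (LINT z|lborel. orbit_sum f (fst z) (snd z) * calV z)"
    by (intro Bochner_Integration.integral_cong refl)
      (auto simp: orbit_sum_def algebra_simps)
  finally show "integral_against (calW w \<gamma>) G_dom f =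
      (LINT z|lborel. orbit_sum f (fst z) (snd z) * calV z)" .
qed

text \<open>After transport to the triangle every monomial is dominated by a power of the larger
  coordinate \<open>Y\<close>, and so is \<open>(Y - X) ^ e\<close>. The dominating function is a
  product of one-variable functions with finite moments.\<close>

lemma integrable_poly2_calV:
  assumes "f \<in> poly2 d"
  shows "integrable lborel (\<lambda>z. f z * calV z)"
proof -
  have mon_int: "integrable lborel (\<lambda>z. mon v z * calV z)" for v
  proof -
    obtain i j where v: "v = (i, j)" by (cases v)
    have "integrable lborel (\<lambda>z. mon v (tri_map z) * tri_dens z)"
    proof (rule Bochner_Integration.integrable_bound)
      show "integrable lborel (\<lambda>z. wt (fst z) * (snd z ^ (i + j + e) * wt (snd z)))"
        using integrable_lborel_mult[OF wt_moment[of 0] wt_moment[of "i + j + e"]] by simp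
      show "(\<lambda>z. mon v (tri_map z) * tri_dens z) \<in> borel_measurable lborel" by measurable
      have "norm (mon v (tri_map z) * tri_dens z) \<le>
          norm (wt (fst z) * (snd z ^ (i + j + e) * wt (snd z)))" for z
      proof (cases "z \<in> Triangle")
        case True
        obtain X Y where z: "z = (X, Y)" by (cases z)
        obtain x y where xy: "tri_map (X, Y) = (x, y)" by (cases "tri_map (X, Y)")
        have XY: "1 < X" "X < Y" using True z by (auto simp: Triangle_def)
        note props = tri_map_props[OF _ _ xy]
        have "mon v (tri_map z) \<le> (x * y) ^ (i + j)"
          using mon_bound[of x y i j] props XY by (simp add: mon_def v z xy)
        also have "\<dots> \<le> Y ^ (i + j)"
          using props XY by (intro power_mono) auto
        finally have 1: "mon v (tri_map z) \<le> Y ^ (i + j)" .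
        have 2: "(Y - X) ^ e \<le> Y ^ e" using XY by (intro power_mono) auto
        have 0: "0 \<le> mon v (tri_map z)" using props XY by (simp add: mon_def v z xy)
        have "mon v (tri_map z) * (Y - X) ^ e \<le> Y ^ (i + j) * Y ^ e"
          using 0 1 2 XY by (intro mult_mono) auto
        then have "wt X * wt Y * (mon v (tri_map z) * (Y - X) ^ e) \<le> wt X * wt Y * (Y ^ (i + j) * Y ^ e)"
          by (intro mult_left_mono) auto
        moreover have "norm (mon v (tri_map z) * tri_dens z) = wt X * wt Y * (mon v (tri_map z) * (Y - X) ^ e)"
          using True 0 XY by (simp add: tri_dens_def z abs_mult)
        moreover have "norm (wt (fst z) * (snd z ^ (i + j + e) * wt (snd z))) = wt X * wt Y * (Y ^ (i + j) * Y ^ e)"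
          using XY by (simp add: z abs_mult power_add)
        ultimately show ?thesis by simp
      qed (simp add: tri_dens_def)
      then show "AE z in lborel. norm (mon v (tri_map z) * tri_dens z) \<le>
          norm (wt (fst z) * (snd z ^ (i + j + e) * wt (snd z)))" by simp
    qed
    then show ?thesis using integrable_calV_iff(1)[of "mon v"] by simp
  qed
  obtain c where f: "f = (\<lambda>z. \<Sum>v\<in>expo d. c v * mon v z)" using assms unfolding poly2_eq by auto
  show ?thesis unfolding f sum_distrib_right mult.assoc
    by (intro Bochner_Integration.integrable_sum integrable_mult_right mon_int)
qed

lemma
  assumes "f \<in> poly2 d"
  shows set_integrable_G_dom: "set_integrable lborel G_dom (\<lambda>z. f z * calW w \<gamma> z)"
    and integral_against_eq:
      "integral_against (calW w \<gamma>) G_dom f = (LINT z|lborel. orbit_sum f (fst z) (snd z) * calV z)"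
  using integral_G_dom[OF assms integrable_poly2_calV[where d = d]] by simp_all

section \<open>Symmetrization and positivity\<close>

definition full_dens :: "real \<times> real \<Rightarrow> real" where
  "full_dens z = wt (fst z) * wt (snd z) * (snd z - fst z) ^ e"

text \<open>The exceptional lines form the zero set of the cubic
  \<open>(x - 1) * (y - 1) * (x - y)\<close>.\<close>

lemma AE_off_diagonal:
  "AE z in (lborel :: (real \<times> real) measure). fst z \<noteq> 1 \<and> snd z \<noteq> 1 \<and> fst z \<noteq> snd z"
proof -
  let ?f = "\<lambda>z. (mon (1, 0) z + (- 1) * mon (0, 0) z) * (mon (0, 1) z + (- 1) * mon (0, 0) z)
    * (mon (1, 0) z + (- 1) * mon (0, 1) z)"
  have "?f \<in> poly2 (1 + 1 + 1)"
    by (intro poly2_mult poly2_add poly2_cmult poly2_mon) auto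
  moreover have "?f (2, 3) \<noteq> 0" by (simp add: mon_def)
  then have "?f \<noteq> (\<lambda>z. 0)" by metis
  ultimately have "AE z in lborel. ?f z \<noteq> 0" by (rule poly2_AE_nonzero)
  then show ?thesis by (auto elim!: eventually_mono simp: mon_def)
qed

text \<open>Evenness of \<open>e\<close> makes the density invariant under the swap. The identity is
  only almost everywhere: on the boundary lines, and for \<open>e = 0\<close> on the diagonal, the
  left side may be positive while the right side is 0.\<close>

lemma AE_symmetrized_dens:
  assumes "even e"
  shows "AE z in lborel. full_dens z = tri_dens z + tri_dens (prod.swap z)"
  using AE_off_diagonal
proof eventually_elim
  case (elim z)
  obtain X Y where z: "z = (X, Y)" by (cases z)
  have pow: "(X - Y) ^ e = (Y - X) ^ e" using assms by (metis minus_diff_eq power_minus_even)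
  consider "X < 1 \<or> Y < 1" | "1 < X" "X < Y" | "1 < Y" "Y < X" using elim z by fastforce
  then show ?case
  proof cases
    case 1
    then show ?thesis by (auto simp: z full_dens_def tri_dens_def wt_def Triangle_def)
  qed (auto simp: z full_dens_def tri_dens_def Triangle_def pow mult.commute)
qed

lemma integral_symmetrized:
  assumes "even e" and [measurable]: "h \<in> borel_measurable borel"
    and int: "integrable lborel (\<lambda>z. h z * tri_dens z)"
    and symm: "\<And>z. z \<in> Triangle \<Longrightarrow> h (prod.swap z) = h z"
  shows "integrable lborel (\<lambda>z. h z * full_dens z)"
    and "(LINT z|lborel. h z * full_dens z) = 2 * (LINT z|lborel. h z * tri_dens z)"
proof -
  have full_m [measurable]: "full_dens \<in> borel_measurable borel"
    unfolding full_dens_def borel_prod[symmetric] by measurable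
  have eq: "(\<lambda>z. h z * tri_dens z) = (\<lambda>z. h (prod.swap z) * tri_dens z)"
    using symm by (auto simp: tri_dens_def fun_eq_iff split: split_indicator)
  have m: "(\<lambda>z. h (prod.swap z) * tri_dens z) \<in> borel_measurable borel" by measurable
  have int': "integrable lborel (\<lambda>z. h z * tri_dens (prod.swap z))"
    and same: "(LINT z|lborel. h z * tri_dens (prod.swap z)) = (LINT z|lborel. h z * tri_dens z)"
    using preserving_integral[OF lborel_distr_swap swap_measurable m] int
    unfolding eq by simp_all
  have AE: "AE z in lborel. h z * full_dens z = h z * tri_dens z + h z * tri_dens (prod.swap z)"
    using AE_symmetrized_dens[OF assms(1)] by eventually_elim (simp add: distrib_left)
  have sum: "integrable lborel (\<lambda>z. h z * tri_dens z + h z * tri_dens (prod.swap z))"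
    using int int' by simp
  show "integrable lborel (\<lambda>z. h z * full_dens z)"
    by (subst integrable_cong_AE[OF _ _ AE]) (use sum in \<open>auto\<close>)
  have "(LINT z|lborel. h z * full_dens z) = (LINT z|lborel. h z * tri_dens z + h z * tri_dens (prod.swap z))"
    by (rule integral_cong_AE[OF _ _ AE]) auto
  also have "\<dots> = 2 * (LINT z|lborel. h z * tri_dens z)" using int int' same by simp
  finally show "(LINT z|lborel. h z * full_dens z) = 2 * (LINT z|lborel. h z * tri_dens z)" .
qed

lemma integral_wt: "(LINT t|lborel. t ^ k * wt t) = (LINT t:{1..}|lborel. t ^ k * w t)"
  unfolding set_lebesgue_integral_def
  by (intro Bochner_Integration.integral_cong) (auto simp: wt_def)

text \<open>Otherwise the symmetrized density would vanish almost everywhere; off the diagonal the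
  power of \<open>Y - X\<close> cancels, leaving the product weight, whose integral is the square of
  the positive integral of \<open>w\<close>.\<close>

lemma calV_not_AE_zero:
  assumes "even e"
  shows "\<not> (AE z in lborel. calV z = 0)"
proof
  assume "AE z in lborel. calV z = 0"
  then have "(LINT z|lborel. 1 * calV z) = 0" by (subst integral_eq_zero_AE) auto
  then have "(LINT z|lborel. tri_dens z) = 0"
    using integrable_calV_iff(2)[of "\<lambda>_. 1"] by simp
  moreover have tri_int: "integrable lborel (\<lambda>z. 1 * tri_dens z)"
  proof -
    have "integrable lborel (\<lambda>z. mon (0, 0) z * calV z)"
      by (rule integrable_poly2_calV[OF poly2_mon[of _ 0]]) simp
    then show ?thesis using integrable_calV_iff(1)[of "\<lambda>_. 1"] by simp
  qed
  ultimately have "(LINT z|lborel. full_dens z) = 0" and int: "integrable lborel full_dens"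
    using integral_symmetrized[OF assms _ tri_int] by simp_all
  moreover have "0 \<le> full_dens z" for z
    using assms by (auto simp: full_dens_def intro!: mult_nonneg_nonneg zero_le_even_power)
  ultimately have "AE z in lborel. full_dens z = 0"
    by (subst (asm) integral_nonneg_eq_0_iff_AE) auto
  with AE_off_diagonal have "AE z in lborel. wt (fst z) * wt (snd z) = 0"
    by eventually_elim (auto simp: full_dens_def)
  then have "(LINT z|lborel. wt (fst z) * wt (snd z)) = 0" by (rule integral_eq_zero_AE)
  moreover have "(LINT z|lborel. wt (fst z) * wt (snd z)) = (LINT t|lborel. wt t) * (LINT t|lborel. wt t)"
    using integral_lborel_mult[of wt wt] wt_moment[of 0] by simp
  moreover have "0 < (LINT t|lborel. wt t)"
    using integral_wt[of 0] weight by (simp add: weight_fun_def)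
  ultimately show False by simp
qed

text \<open>All four terms of the orbit sum are nonnegative, and the identity term alone is already
  positive, since \<open>f\<close> vanishes only on a null set and \<open>calV\<close> does not
  vanish almost everywhere.\<close>

lemma integral_square_pos:
  assumes "even e" "f \<in> poly2 d" "f \<noteq> (\<lambda>z. 0)"
  shows "0 < integral_against (calW w \<gamma>) G_dom (\<lambda>z. (f z)\<^sup>2)"
proof -
  let ?q = "\<lambda>z. (f z)\<^sup>2"
  have q: "?q \<in> poly2 (d + d)" using poly2_mult[OF assms(2,2)] by (simp add: power2_eq_square)
  have int: "integrable lborel (\<lambda>z. ?q z * calV z)" by (rule integrable_poly2_calV[OF q])
  have "\<not> (AE z in lborel. ?q z * calV z = 0)"
  proof
    assume "AE z in lborel. ?q z * calV z = 0"
    with poly2_AE_nonzero[OF assms(2,3)] have "AE z in lborel. calV z = 0"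
      by eventually_elim auto
    with calV_not_AE_zero[OF assms(1)] show False by simp
  qed
  then have "(LINT z|lborel. ?q z * calV z) \<noteq> 0"
    using integral_nonneg_eq_0_iff_AE[OF int] by simp
  moreover have "0 \<le> (LINT z|lborel. ?q z * calV z)" by (rule integral_nonneg_AE) simp
  ultimately have pos: "0 < (LINT z|lborel. ?q z * calV z)" by linarith
  have orbit: "orbit_sum ?q (fst z) (snd z) * calV z = ?q z * calV z + ?q (prod.swap z) * calV z
      + ?q (- z) * calV z + ?q (- prod.swap z) * calV z" for z
    by (cases z) (simp add: orbit_sum_def algebra_simps)
  have "(LINT z|lborel. ?q z * calV z) \<le> (LINT z|lborel. orbit_sum ?q (fst z) (snd z) * calV z)"
  proof (rule integral_mono[OF int])
    show "integrable lborel (\<lambda>z. orbit_sum ?q (fst z) (snd z) * calV z)"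
      unfolding orbit using poly2_swap[OF poly2_minus[OF q]]
      by (intro Bochner_Integration.integrable_add int integrable_poly2_calV[OF poly2_swap[OF q]]
          integrable_poly2_calV[OF poly2_minus[OF q]])
        (auto dest: integrable_poly2_calV)
    show "?q z * calV z \<le> orbit_sum ?q (fst z) (snd z) * calV z" for z
      unfolding orbit by simp
  qed
  with pos show ?thesis unfolding integral_against_eq[OF q] by simp
qed

end

section \<open>Orbit sums and Gaussian quadrature\<close>

text \<open>Polynomials of degree at most \<open>M\<close> in each variable separately, the natural
  domain of a product quadrature. The inductive form lets closure properties and quadrature
  exactness follow by rule induction from monomials.\<close>

inductive_set bipoly :: "nat \<Rightarrow> (real \<times> real \<Rightarrow> real) set" for M :: nat where
  bipoly_mon: "i \<le> M \<Longrightarrow> j \<le> M \<Longrightarrow> mon (i, j) \<in> bipoly M"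
| bipoly_add: "f \<in> bipoly M \<Longrightarrow> g \<in> bipoly M \<Longrightarrow> (\<lambda>z. f z + g z) \<in> bipoly M"
| bipoly_cmult: "f \<in> bipoly M \<Longrightarrow> (\<lambda>z. c * f z) \<in> bipoly M"

lemma bipoly_const: "(\<lambda>z. c) \<in> bipoly M"
  using bipoly_cmult[OF bipoly_mon[of 0 M 0], of c] by simp

lemma bipoly_diff: "f \<in> bipoly M \<Longrightarrow> g \<in> bipoly M \<Longrightarrow> (\<lambda>z. f z - g z) \<in> bipoly M"
  using bipoly_add[OF _ bipoly_cmult[of g M "- 1"], of f] by simp

lemma bipoly_mult:
  assumes f: "f \<in> bipoly M" and g: "g \<in> bipoly N"
  shows "(\<lambda>z. f z * g z) \<in> bipoly (M + N)"
  using f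
proof induction
  case (bipoly_mon i j)
  show ?case using g
  proof induction
    case (bipoly_mon i' j')
    then show ?case unfolding mon_mult using \<open>i \<le> M\<close> \<open>j \<le> M\<close>
      by (simp add: bipoly.bipoly_mon)
  next
    case (bipoly_add f g)
    then show ?case by (simp add: distrib_left bipoly.bipoly_add)
  next
    case (bipoly_cmult f c)
    then show ?case using bipoly.bipoly_cmult[of _ "M + N" c] by (simp add: mult.left_commute)
  qed
next
  case (bipoly_add f g)
  then show ?case by (simp add: distrib_right bipoly.bipoly_add)
next
  case (bipoly_cmult f c)
  then show ?case using bipoly.bipoly_cmult[of _ "M + N" c] by (simp add: mult.assoc)
qed

lemma bipoly_power: "f \<in> bipoly M \<Longrightarrow> (\<lambda>z. f z ^ k) \<in> bipoly (k * M)"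
proof (induction k)
  case 0
  then show ?case by (simp add: bipoly_const)
next
  case (Suc k)
  then show ?case using bipoly_mult[of f M "\<lambda>z. f z ^ k" "k * M"] by simp
qed

lemma bipoly_mono:
  assumes "M \<le> N" "f \<in> bipoly M" shows "f \<in> bipoly N"
  using assms(2)
  by induction (use assms(1) in \<open>auto intro: bipoly.intros\<close>)

lemma borel_measurable_bipoly: "f \<in> bipoly M \<Longrightarrow> f \<in> borel_measurable borel"
  by (induction rule: bipoly.induct) auto

lemma bipoly_fst: "fst \<in> bipoly 1" and bipoly_snd: "snd \<in> bipoly 1"
proof -
  have "mon (1, 0) = fst" "mon (0, 1) = snd" by (auto simp: mon_def fun_eq_iff)
  then show "fst \<in> bipoly 1" "snd \<in> bipoly 1"
    using bipoly_mon[of 1 1 0] bipoly_mon[of 0 1 1] by simp_all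
qed

text \<open>A relation rather than a map: it is symmetric in \<open>x\<close> and \<open>y\<close>
  and in the components of \<open>z\<close>, so it covers \<open>tri_map\<close> as well as nodes
  with indices in either order.\<close>

definition coords :: "real \<Rightarrow> real \<Rightarrow> real \<times> real \<Rightarrow> bool" where
  "coords x y z \<longleftrightarrow> 2 * x * y = fst z + snd z \<and> x\<^sup>2 + y\<^sup>2 - 1 = fst z * snd z"

text \<open>Newton's recurrence for the power sums of \<open>a = x\<^sup>2\<close> and
  \<open>b = y\<^sup>2\<close>: the next sum is \<open>a + b\<close> times the last minus
  \<open>ab\<close> times the one before. Here \<open>a + b = XY + 1\<close> has degree 1 in each
  variable and \<open>ab = ((X + Y) / 2)\<^sup>2\<close> has degree 2, so the degree grows by one
  per step.\<close>

lemma power_sum_bipoly: "\<exists>Q\<in>bipoly r. \<forall>x y z. coords x y z \<longrightarrow> x ^ (2 * r) + y ^ (2 * r) = Q z"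
proof (induction r rule: induct_nat_012)
  case 0
  then show ?case by (intro bexI[of _ "\<lambda>z. 2"] bipoly_const) simp
next
  case 1
  have "(\<lambda>z. mon (1, 1) z + 1) \<in> bipoly 1" by (intro bipoly_add bipoly_mon bipoly_const) auto
  then show ?case
    by (intro bexI[of _ "\<lambda>z. mon (1, 1) z + 1"]) (auto simp: coords_def mon_def algebra_simps power2_eq_square)
next
  case (ge2 r)
  then obtain P Q where P: "P \<in> bipoly r" "\<And>x y z. coords x y z \<Longrightarrow> x ^ (2 * r) + y ^ (2 * r) = P z"
    and Q: "Q \<in> bipoly (Suc r)" "\<And>x y z. coords x y z \<Longrightarrow> x ^ (2 * Suc r) + y ^ (2 * Suc r) = Q z"
    by blast
  have e1: "(\<lambda>z. mon (1, 1) z + 1) \<in> bipoly 1" by (intro bipoly_add bipoly_mon bipoly_const) auto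
  have e2: "(\<lambda>z. 1 / 4 * (fst z + snd z) ^ 2) \<in> bipoly (2 * 1)"
    by (intro bipoly_cmult bipoly_power bipoly_add bipoly_fst bipoly_snd)
  have "(\<lambda>z. (mon (1, 1) z + 1) * Q z - (1 / 4 * (fst z + snd z) ^ 2) * P z) \<in> bipoly (Suc (Suc r))"
    using bipoly_mult[OF e1 Q(1)] bipoly_mult[OF e2 P(1)] by (intro bipoly_diff) simp_all
  moreover have "x ^ (2 * Suc (Suc r)) + y ^ (2 * Suc (Suc r)) =
      (mon (1, 1) z + 1) * Q z - (1 / 4 * (fst z + snd z) ^ 2) * P z" if c: "coords x y z" for x y z
  proof -
    have 1: "mon (1, 1) z + 1 = x\<^sup>2 + y\<^sup>2" using c by (simp add: coords_def mon_def)
    have 2: "1 / 4 * (fst z + snd z) ^ 2 = x\<^sup>2 * y\<^sup>2"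
    proof -
      have "fst z + snd z = 2 * (x * y)" using c by (simp add: coords_def)
      then show ?thesis by (simp add: power_mult_distrib)
    qed
    show ?thesis unfolding 1 2 P(2)[OF c, symmetric] Q(2)[OF c, symmetric]
      by (simp add: algebra_simps power_add power2_eq_square)
  qed
  ultimately show ?case
    by (intro bexI[of _ "\<lambda>z. (mon (1, 1) z + 1) * Q z - (1 / 4 * (fst z + snd z) ^ 2) * P z"]) auto
qed

text \<open>Monomials of odd total degree cancel against their negatives. In the even case
  \<open>j = i + 2r\<close>, the orbit sum is \<open>2 * (xy)^i * (x^(2r) + y^(2r))\<close>, of
  degree \<open>i + r\<close> in each variable, half of the total degree. The odd bound
  \<open>2 * M + 1\<close> therefore costs nothing beyond \<open>2 * M\<close>.\<close>

lemma orbit_mon_bipoly: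
  assumes "i + j \<le> 2 * M + 1"
  shows "\<exists>Q\<in>bipoly M. \<forall>x y z. coords x y z \<longrightarrow> orbit_sum (mon (i, j)) x y = Q z"
  using assms
proof (induction i j rule: linorder_wlog)
  case (le i j)
  have orbit: "orbit_sum (mon (i, j)) x y = (1 + (- 1) ^ (i + j)) * (x ^ i * y ^ j + y ^ i * x ^ j)" for x y
    using mon_uminus[of "(i, j)" "(x, y)"] mon_uminus[of "(i, j)" "(y, x)"]
    by (simp add: orbit_sum_def mon_def algebra_simps)
  show ?case
  proof (cases "even (i + j)")
    case False
    then show ?thesis by (intro bexI[of _ "\<lambda>z. 0"] bipoly_const) (simp add: orbit)
  next
    case True
    then obtain r where r: "j = i + 2 * r" using le by (metis add.commute dvdE even_diff_nat le_add_diff_inverse not_less)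
    then have M: "i + r \<le> M" using le by simp
    obtain Q where Q: "Q \<in> bipoly r" "\<And>x y z. coords x y z \<Longrightarrow> x ^ (2 * r) + y ^ (2 * r) = Q z"
      using power_sum_bipoly[of r] by blast
    have "(\<lambda>z. (1 / 2 * (fst z + snd z)) ^ i) \<in> bipoly (i * 1)"
      by (intro bipoly_power bipoly_cmult bipoly_add bipoly_fst bipoly_snd)
    from bipoly_cmult[OF bipoly_mult[OF this Q(1)], of 2] M
    have B: "(\<lambda>z. 2 * ((1 / 2 * (fst z + snd z)) ^ i * Q z)) \<in> bipoly M"
      by (intro bipoly_mono[of "i * 1 + r" M]) simp_all
    have "orbit_sum (mon (i, j)) x y = 2 * ((1 / 2 * (fst z + snd z)) ^ i * Q z)" if c: "coords x y z" for x y z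
    proof -
      have "1 / 2 * (fst z + snd z) = x * y" using c by (simp add: coords_def)
      then show ?thesis unfolding orbit Q(2)[OF c, symmetric] using True
        by (simp add: r power_add power_mult_distrib algebra_simps)
    qed
    with B show ?thesis
      by (intro bexI[of _ "\<lambda>z. 2 * ((1 / 2 * (fst z + snd z)) ^ i * Q z)"]) auto
  qed
next
  case (sym i j)
  have "orbit_sum (mon (i, j)) x y = orbit_sum (mon (j, i)) x y" for x y
    by (simp add: orbit_sum_def mon_def mult.commute)
  with sym show ?case by (simp add: add.commute)
qed

lemma orbit_sum_bipoly:
  assumes "f \<in> poly2 (2 * M + 1)"
  obtains Q where "Q \<in> bipoly M" "\<And>x y z. coords x y z \<Longrightarrow> orbit_sum f x y = Q z"
proof -
  obtain c where f: "f = (\<lambda>z. \<Sum>e\<in>expo (2 * M + 1). c e * mon e z)" using assms unfolding poly2_eq by auto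
  have "\<exists>Q\<in>bipoly M. \<forall>x y z. coords x y z \<longrightarrow> orbit_sum (\<lambda>z. \<Sum>e\<in>E. c e * mon e z) x y = Q z"
    if "E \<subseteq> expo (2 * M + 1)" for E
    using finite_subset[OF that finite_expo] that
  proof (induction E rule: finite_induct)
    case empty
    then show ?case by (intro bexI[of _ "\<lambda>z. 0"] bipoly_const) (simp add: orbit_sum_def)
  next
    case (insert e E)
    then obtain P where P: "P \<in> bipoly M"
      "\<And>x y z. coords x y z \<Longrightarrow> orbit_sum (\<lambda>z. \<Sum>e\<in>E. c e * mon e z) x y = P z" by blast
    obtain Q where Q: "Q \<in> bipoly M" "\<And>x y z. coords x y z \<Longrightarrow> orbit_sum (mon e) x y = Q z"
      using orbit_mon_bipoly[of "fst e" "snd e" M] insert.prems by (auto simp: mem_expo)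
    have "orbit_sum (\<lambda>z. \<Sum>e\<in>insert e E. c e * mon e z) x y =
        c e * orbit_sum (mon e) x y + orbit_sum (\<lambda>z. \<Sum>e\<in>E. c e * mon e z) x y" for x y
      using insert.hyps by (simp add: orbit_sum_def algebra_simps)
    moreover have "(\<lambda>z. c e * Q z + P z) \<in> bipoly M" by (intro bipoly.intros P Q)
    ultimately show ?case using P(2) Q(2) by (intro bexI[of _ "\<lambda>z. c e * Q z + P z"]) auto
  qed
  from this[OF order_refl] that show ?thesis unfolding f by blast
qed

lemma bipoly_gauss:
  fixes \<mu> :: "real \<Rightarrow> real"
  assumes "Q \<in> bipoly N" and "finite K"
    and int: "\<And>i. i \<le> N \<Longrightarrow> integrable lborel (\<lambda>t. t ^ i * \<mu> t)"
    and gauss: "\<And>i. i \<le> N \<Longrightarrow> c * (LINT t|lborel. t ^ i * \<mu> t) = (\<Sum>k\<in>K. lam k * x k ^ i)"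
  shows "integrable lborel (\<lambda>z. Q z * (\<mu> (fst z) * \<mu> (snd z))) \<and>
    c\<^sup>2 * (LINT z|lborel. Q z * (\<mu> (fst z) * \<mu> (snd z))) =
      (\<Sum>j\<in>K. \<Sum>k\<in>K. lam j * lam k * Q (x j, x k))"
  using assms(1)
proof induction
  case (bipoly_mon i j)
  have eq: "mon (i, j) z * (\<mu> (fst z) * \<mu> (snd z)) = (fst z ^ i * \<mu> (fst z)) * (snd z ^ j * \<mu> (snd z))" for z
    by (simp add: mon_def)
  have "c\<^sup>2 * (LINT z|lborel. mon (i, j) z * (\<mu> (fst z) * \<mu> (snd z))) =
      (c * (LINT t|lborel. t ^ i * \<mu> t)) * (c * (LINT t|lborel. t ^ j * \<mu> t))"
    unfolding eq integral_lborel_mult[OF int[OF bipoly_mon(1)] int[OF bipoly_mon(2)]]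
    by (simp add: power2_eq_square)
  also have "\<dots> = (\<Sum>j'\<in>K. \<Sum>k\<in>K. lam j' * lam k * mon (i, j) (x j', x k))"
    unfolding gauss[OF bipoly_mon(1)] gauss[OF bipoly_mon(2)] sum_product
    by (simp add: mon_def mult_ac)
  finally show ?case
    unfolding eq using integrable_lborel_mult[OF int[OF bipoly_mon(1)] int[OF bipoly_mon(2)]] by simp
next
  case (bipoly_add f g)
  then show ?case by (simp add: algebra_simps sum.distrib)
next
  case (bipoly_cmult f d)
  then have int: "integrable lborel (\<lambda>z. f z * (\<mu> (fst z) * \<mu> (snd z)))"
    and eq: "c\<^sup>2 * (LINT z|lborel. f z * (\<mu> (fst z) * \<mu> (snd z))) =
      (\<Sum>j\<in>K. \<Sum>k\<in>K. lam j * lam k * f (x j, x k))" by auto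
  have "c\<^sup>2 * (LINT z|lborel. d * f z * (\<mu> (fst z) * \<mu> (snd z))) =
      d * (c\<^sup>2 * (LINT z|lborel. f z * (\<mu> (fst z) * \<mu> (snd z))))"
    unfolding mult.assoc integral_mult_right_zero by (simp only: mult.left_commute)
  also have "\<dots> = (\<Sum>j\<in>K. \<Sum>k\<in>K. lam j * lam k * (d * f (x j, x k)))"
    unfolding eq sum_distrib_left by (simp only: mult.left_commute mult.assoc)
  finally show ?case
    using integrable_mult_right[OF int, of d] by (simp add: mult.assoc)
qed

text \<open>The nodes lie over the pairs of Gaussian points, so an orbit sum at a node is a value of
  the associated polynomial at such a pair.\<close>

lemma coords_nodes:
  "coords (s_node \<theta> j k) (t_node \<theta> j k) (cosh (\<theta> j), cosh (\<theta> k))"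
proof -
  define a where "a = (\<theta> j - \<theta> k) / 2"
  define b where "b = (\<theta> j + \<theta> k) / 2"
  have ab: "\<theta> j = b + a" "\<theta> k = b - a" by (simp_all add: a_def b_def field_simps)
  have "(cosh a)\<^sup>2 + (cosh b)\<^sup>2 - 1 = cosh (\<theta> j) * cosh (\<theta> k)"
  proof -
    have "cosh (\<theta> j) * cosh (\<theta> k) = (cosh b)\<^sup>2 * (cosh a)\<^sup>2 - (sinh b)\<^sup>2 * (sinh a)\<^sup>2"
      by (simp add: ab cosh_add cosh_diff power2_eq_square algebra_simps)
    also have "\<dots> = (cosh a)\<^sup>2 + (cosh b)\<^sup>2 - 1"
      by (simp add: sinh_square_eq algebra_simps)
    finally show ?thesis by simp
  qed
  moreover have "2 * cosh a * cosh b = cosh (\<theta> j) + cosh (\<theta> k)"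
    by (simp add: ab cosh_add cosh_diff)
  ultimately show ?thesis by (simp add: coords_def s_node_def t_node_def a_def b_def)
qed

context triangle_weight
begin

lemma gauss_moments:
  assumes "gauss_quadrature w n x lam" "i \<le> 2 * n - 1"
  shows "c_const w * (LINT t|lborel. t ^ i * wt t) = (\<Sum>k=1..n. lam k * x k ^ i)"
proof -
  have "degree (monom (1::real) i) \<le> 2 * n - 1" using assms(2) by (simp add: degree_monom_eq)
  with assms(1) have "c_const w * (LINT t:{1..}|lborel. poly (monom 1 i) t * w t) =
      (\<Sum>k=1..n. lam k * poly (monom 1 i) (x k))"
    unfolding gauss_quadrature_def by blast
  then show ?thesis by (simp add: poly_monom integral_wt)
qed

text \<open>The factor 1/8 is 1/4 from the change of variables times 1/2 from symmetrization over
  the square.\<close>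

lemma cubature_formula:
  assumes "even e" and gauss: "gauss_quadrature w n x lam"
    and \<theta>: "\<And>k. k \<in> {1..n} \<Longrightarrow> x k = cosh (\<theta> k)"
    and f: "f \<in> poly2 (2 * M + 1)" and M: "M + e \<le> 2 * n - 1"
  shows "(c_const w)\<^sup>2 * integral_against (calW w \<gamma>) G_dom f =
    1 / 8 * (\<Sum>j=1..n. \<Sum>k=1..n. lam j * lam k * (x k - x j) ^ e *
       orbit_sum f (s_node \<theta> j k) (t_node \<theta> j k))"
proof -
  obtain Q where Q: "Q \<in> bipoly M" "\<And>x y z. coords x y z \<Longrightarrow> orbit_sum f x y = Q z"
    using orbit_sum_bipoly[OF f] by blast
  have coords_tri: "coords (fst (tri_map z)) (snd (tri_map z)) z" if "z \<in> Triangle" for z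
    using that tri_map_props(1,2)[of "fst z" "snd z" "fst (tri_map z)" "snd (tri_map z)"]
    by (auto simp: coords_def Triangle_def)
  let ?o = "\<lambda>z. orbit_sum f (fst z) (snd z)"
  have o_Q: "?o (tri_map z) * tri_dens z = Q z * tri_dens z" for z
    using Q(2)[OF coords_tri] by (cases "z \<in> Triangle") (auto simp: tri_dens_def)
  \<comment> \<open>\<open>coords\<close> does not see the order of the components of
    \<open>z\<close>, so \<open>Q\<close> takes the same orbit sum as its value at both
    points.\<close>
  have Q_swap: "Q (prod.swap z) = Q z" if "z \<in> Triangle" for z
  proof -
    have "coords (fst (tri_map z)) (snd (tri_map z)) (prod.swap z)"
      using coords_tri[OF that] by (simp add: coords_def add.commute mult.commute)
    then show ?thesis using Q(2) Q(2)[OF coords_tri[OF that]] by metis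
  qed
  have o_poly: "?o \<in> poly2 (2 * M + 1)"
  proof -
    have "?o = (\<lambda>z. f z + f (prod.swap z) + f (- z) + f (- prod.swap z))"
      by (auto simp: orbit_sum_def fun_eq_iff)
    also have "\<dots> \<in> poly2 (2 * M + 1)"
      using poly2_swap[OF poly2_minus[OF f]] by (intro poly2_add f poly2_swap poly2_minus)
    finally show ?thesis .
  qed
  have o_int: "integrable lborel (\<lambda>z. ?o z * calV z)" by (rule integrable_poly2_calV[OF o_poly])
  have Q_int: "integrable lborel (\<lambda>z. Q z * tri_dens z)"
    using integrable_calV_iff(1)[OF borel_measurable_poly2[OF o_poly]] o_int by (simp add: o_Q)
  have "(\<lambda>z. Q z * (snd z - fst z) ^ e) \<in> bipoly (M + e * 1)"
    by (intro bipoly_mult Q bipoly_power bipoly_diff bipoly_fst bipoly_snd)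
  then have B: "(\<lambda>z. Q z * (snd z - fst z) ^ e) \<in> bipoly (2 * n - 1)"
    using M bipoly_mono[of "M + e * 1" "2 * n - 1"] by simp
  have "integral_against (calW w \<gamma>) G_dom f = (LINT z|lborel. ?o z * calV z)"
    by (rule integral_against_eq[OF f])
  also have "\<dots> = (LINT z|lborel. Q z * tri_dens z) / 4"
    unfolding integrable_calV_iff(2)[OF borel_measurable_poly2[OF o_poly]] o_Q ..
  also have "\<dots> = (LINT z|lborel. Q z * full_dens z) / 8"
    using integral_symmetrized(2)[OF assms(1) borel_measurable_bipoly[OF Q(1)] Q_int Q_swap] by simp
  also have "\<dots> = (LINT z|lborel. Q z * (snd z - fst z) ^ e * (wt (fst z) * wt (snd z))) / 8"
    by (simp add: full_dens_def mult_ac)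
  finally have "(c_const w)\<^sup>2 * integral_against (calW w \<gamma>) G_dom f = 1 / 8 * ((c_const w)\<^sup>2 *
      (LINT z|lborel. Q z * (snd z - fst z) ^ e * (wt (fst z) * wt (snd z))))"
    by simp
  also have "\<dots> = 1 / 8 * (\<Sum>j=1..n. \<Sum>k=1..n. lam j * lam k * (Q (x j, x k) * (x k - x j) ^ e))"
    using bipoly_gauss[OF B, of "{1..n}" wt "c_const w" lam x] wt_moment gauss_moments[OF gauss] by simp
  also have "\<dots> = 1 / 8 * (\<Sum>j=1..n. \<Sum>k=1..n. lam j * lam k * (x k - x j) ^ e *
       orbit_sum f (s_node \<theta> j k) (t_node \<theta> j k))"
    using \<theta> Q(2)[OF coords_nodes] by (simp add: mult_ac)
  finally show ?thesis .
qed

end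

section \<open>Minimality and the nodes\<close>

lemma c_const_pos: "weight_fun w \<Longrightarrow> 0 < c_const w"
  by (simp add: weight_fun_def c_const_def)

text \<open>It serves both weights, with m = n and m = n - 1. Odd functions have zero orbit sums and
  hence zero integral, as \<open>moeller_bound\<close> demands.\<close>

lemma (in triangle_weight) minimal_cubature_ruleI:
  assumes "even e" "m \<ge> 1" "finite X" and card: "card X = 2 * m * (m + 1)"
    and exact: "\<And>f. f \<in> poly2 (4 * m - 1) \<Longrightarrow>
      (c_const w)\<^sup>2 * integral_against (calW w \<gamma>) G_dom f = (\<Sum>z\<in>X. \<mu> z * f z)"
  shows "minimal_cubature_rule ((c_const w)\<^sup>2) (calW w \<gamma>) G_dom (4 * m - 1) X \<mu>"
proof -
  let ?L = "\<lambda>f. (c_const w)\<^sup>2 * integral_against (calW w \<gamma>) G_dom f"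
  have pos: "0 < ?L (\<lambda>z. (f z)\<^sup>2)" if "f \<in> poly2 d" "f \<noteq> (\<lambda>z. 0)" for f d
    using integral_square_pos[OF assms(1) that] c_const_pos[OF weight] by simp
  have not_exact: "\<not> (\<forall>f\<in>poly2 (4 * m - 1 + 1). ?L f = (\<Sum>z\<in>X. \<mu> z * f z))"
  proof
    assume all: "\<forall>f\<in>poly2 (4 * m - 1 + 1). ?L f = (\<Sum>z\<in>X. \<mu> z * f z)"
    \<comment> \<open>This dimension exceeds the number of nodes by m + 1.\<close>
    have "dim_poly2 (2 * m) = (2 * m + 1) * (m + 1)" by (simp add: dim_poly2_eq)
    then have "card X < dim_poly2 (2 * m)" using card by (simp add: algebra_simps)
    from exists_poly2_vanishing[OF \<open>finite X\<close> this] obtain f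
      where f: "f \<in> poly2 (2 * m)" "f \<noteq> (\<lambda>z. 0)" "\<And>z. z \<in> X \<Longrightarrow> f z = 0" by blast
    have "(\<lambda>z. (f z)\<^sup>2) \<in> poly2 (4 * m - 1 + 1)"
      using poly2_mult[OF f(1,1)] \<open>m \<ge> 1\<close> by (simp add: power2_eq_square)
    with all have "?L (\<lambda>z. (f z)\<^sup>2) = (\<Sum>z\<in>X. \<mu> z * (f z)\<^sup>2)" by blast
    also have "\<dots> = 0" by (rule sum.neutral) (simp add: f(3))
    finally show False using pos[OF f(1,2)] by linarith
  qed
  have odd: "?L f = 0" if "f \<in> poly2 (4 * m - 1)" "\<And>z. f (- z) = - f z" for f
  proof -
    have "orbit_sum f x y = 0" for x y
      using that(2)[of "(x, y)"] that(2)[of "(y, x)"] by (simp add: orbit_sum_def)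
    then show ?thesis using integral_against_eq[OF that(1)] by simp
  qed
  have "card X \<le> card Y" if "cubature_rule ((c_const w)\<^sup>2) (calW w \<gamma>) G_dom (4 * m - 1) Y \<nu>" for Y \<nu>
    unfolding card
  proof (rule moeller_bound[where L = ?L and \<nu> = \<nu>])
    show "?L f = (\<Sum>z\<in>Y. \<nu> z * f z)" if "f \<in> poly2 (4 * m - 1)" for f
      using \<open>cubature_rule _ _ _ _ Y \<nu>\<close> that unfolding cubature_rule_def by blast
    show "finite Y" using \<open>cubature_rule _ _ _ _ Y \<nu>\<close> unfolding cubature_rule_def by blast
  qed (fact odd pos \<open>m \<ge> 1\<close>)+
  then show ?thesis
    unfolding minimal_cubature_rule_def cubature_rule_def
    using \<open>finite X\<close> set_integrable_G_dom exact not_exact by blast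
qed

text \<open>Turns a weighted sum of orbit sums into a rule on a set of distinct nodes. The condition
  \<open>0 < s p < t p\<close> puts each representative inside the fundamental sector, so orbits
  have four points and different representatives have disjoint orbits.\<close>

lemma orbit_rule:
  fixes s t a :: "'p \<Rightarrow> real"
  assumes "finite J" and inj: "inj_on (\<lambda>p. (s p, t p)) J"
    and st: "\<And>p. p \<in> J \<Longrightarrow> 0 < s p \<and> s p < t p"
  obtains X \<mu> where "finite X" "card X = 4 * card J"
    "\<And>f. (\<Sum>z\<in>X. \<mu> z * f z) = (\<Sum>p\<in>J. a p * orbit_sum f (s p) (t p))"
proof -
  define S where "S = {id, prod.swap, uminus, \<lambda>z. - prod.swap z :: real \<times> real}"
  define P where "P = (\<lambda>(p, \<sigma>). \<sigma> (s p, t p) :: real \<times> real)"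
  have distinct: "id \<noteq> (prod.swap :: real \<times> real \<Rightarrow> _)" "id \<noteq> (uminus :: real \<times> real \<Rightarrow> _)"
    "id \<noteq> (\<lambda>z. - prod.swap z :: real \<times> real)" "prod.swap \<noteq> (uminus :: real \<times> real \<Rightarrow> _)"
    "prod.swap \<noteq> (\<lambda>z. - prod.swap z :: real \<times> real)" "uminus \<noteq> (\<lambda>z. - prod.swap z :: real \<times> real)"
    by (auto dest!: fun_cong[of _ _ "(1, 2)"])
  have S: "finite S" "card S = 4" unfolding S_def using distinct by auto
  have inj_P: "inj_on P (J \<times> S)"
  proof (rule inj_onI)
    fix u v assume "u \<in> J \<times> S" "v \<in> J \<times> S" "P u = P v"
    then obtain p \<sigma> q \<tau> where uv: "u = (p, \<sigma>)" "v = (q, \<tau>)" "p \<in> J" "q \<in> J" "\<sigma> \<in> S" "\<tau> \<in> S"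
      and eq: "\<sigma> (s p, t p) = \<tau> (s q, t q)" by (auto simp: P_def)
    have "\<sigma> = \<tau> \<and> s p = s q \<and> t p = t q"
      using uv(5,6) eq st[OF uv(3)] st[OF uv(4)] unfolding S_def by auto
    with inj uv show "u = v" by (auto dest: inj_onD)
  qed
  define X where "X = P ` (J \<times> S)"
  \<comment> \<open>The weight of a node is recovered from the unique index and symmetry that
    produce it.\<close>
  define \<mu> where "\<mu> z = a (fst (inv_into (J \<times> S) P z))" for z
  show ?thesis
  proof
    show "finite X" using \<open>finite J\<close> S by (simp add: X_def)
    show "card X = 4 * card J" using S unfolding X_def by (simp add: card_image[OF inj_P] card_cartesian_product)
    fix f :: "real \<times> real \<Rightarrow> real"
    have "(\<Sum>z\<in>X. \<mu> z * f z) = (\<Sum>v\<in>J \<times> S. \<mu> (P v) * f (P v))"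
      unfolding X_def by (simp add: sum.reindex[OF inj_P])
    also have "\<dots> = (\<Sum>v\<in>J \<times> S. a (fst v) * f (P v))"
      by (intro sum.cong refl) (auto simp: \<mu>_def inv_into_f_f[OF inj_P])
    also have "\<dots> = (\<Sum>p\<in>J. \<Sum>\<sigma>\<in>S. a p * f (\<sigma> (s p, t p)))"
      by (simp add: sum.cartesian_product P_def case_prod_unfold)
    also have "\<dots> = (\<Sum>p\<in>J. a p * orbit_sum f (s p) (t p))"
      unfolding S_def using distinct
      by (intro sum.cong refl) (simp add: orbit_sum_def algebra_simps)
    finally show "(\<Sum>z\<in>X. \<mu> z * f z) = (\<Sum>p\<in>J. a p * orbit_sum f (s p) (t p))" .
  qed
qed

section \<open>Geometry of the nodes and sums over index pairs\<close>

lemma s_node_commute: "s_node \<theta> j k = s_node \<theta> k j"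
  unfolding s_node_def by (metis cosh_minus minus_diff_eq minus_divide_left)

lemma t_node_commute: "t_node \<theta> j k = t_node \<theta> k j"
  by (simp add: t_node_def add.commute)

lemma nodes_ordered:
  assumes "0 < \<theta> j" "0 < \<theta> k"
  shows "0 < s_node \<theta> j k" "s_node \<theta> j k < t_node \<theta> j k"
proof -
  have "s_node \<theta> j k = cosh (\<bar>\<theta> j - \<theta> k\<bar> / 2)"
    using cosh_real_abs[of "(\<theta> j - \<theta> k) / 2"] by (simp add: s_node_def)
  also have "\<dots> < t_node \<theta> j k"
    unfolding t_node_def using assms by (intro cosh_real_strict_mono) auto
  finally show "s_node \<theta> j k < t_node \<theta> j k" .
  show "0 < s_node \<theta> j k" by (simp add: s_node_def)
qed

text \<open>A node determines the sum and the product of \<open>x j\<close> and \<open>x k\<close>,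
  hence the unordered pair of Gaussian points; \<open>j \<le> k\<close> restores the order.\<close>

lemma inj_on_nodes:
  assumes x: "inj_on x {1..n}" "\<And>k. k \<in> {1..n} \<Longrightarrow> x k = cosh (\<theta> k)"
    and J: "J \<subseteq> (SIGMA k:{1..n::nat}. {1..k})"
  shows "inj_on (\<lambda>p. (s_node \<theta> (snd p) (fst p), t_node \<theta> (snd p) (fst p))) J"
proof (rule inj_onI)
  fix p q assume pq: "p \<in> J" "q \<in> J"
    and eq: "(s_node \<theta> (snd p) (fst p), t_node \<theta> (snd p) (fst p)) =
      (s_node \<theta> (snd q) (fst q), t_node \<theta> (snd q) (fst q))"
  obtain k j k' j' where kj: "p = (k, j)" "q = (k', j')" by (cases p, cases q)
  have mem: "k \<in> {1..n}" "k' \<in> {1..n}" "j \<in> {1..n}" "j' \<in> {1..n}" "j \<le> k" "j' \<le> k'"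
    using pq J kj by auto
  have "x j = x j' \<and> x k = x k' \<or> x j = x k' \<and> x k = x j'"
    using coords_nodes[of \<theta> j k] coords_nodes[of \<theta> j' k'] eq kj x(2) mem
    by (intro sum_prod_eq_iff) (auto simp: coords_def)
  with x(1) mem have "j = j' \<and> k = k' \<or> j = k' \<and> k = j'" by (auto dest: inj_onD)
  with mem kj show "p = q" by auto
qed

lemma sum_symmetric:
  fixes A :: "nat \<Rightarrow> nat \<Rightarrow> real"
  assumes "\<And>j k. A j k = A k j"
  shows "(\<Sum>j=1..n. \<Sum>k=1..n. A j k) = 2 * (\<Sum>k=1..n. \<Sum>j=1..k. (if j = k then 1 / 2 else 1) * A j k)"
proof (induction n)
  case (Suc n)
  have "(\<Sum>j=1..Suc n. \<Sum>k=1..Suc n. A j k) =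
      (\<Sum>j=1..n. \<Sum>k=1..n. A j k) + (\<Sum>j=1..n. A j (Suc n)) + (\<Sum>k=1..n. A (Suc n) k) + A (Suc n) (Suc n)"
    by (simp add: sum.distrib)
  also have "(\<Sum>k=1..n. A (Suc n) k) = (\<Sum>j=1..n. A j (Suc n))" using assms by simp
  also have "(\<Sum>j=1..n. A j (Suc n)) = (\<Sum>j=1..n. (if j = Suc n then 1 / 2 else 1) * A j (Suc n))"
    by (intro sum.cong) auto
  finally show ?case using Suc by simp
qed simp

lemma sum_symmetric_zero_diagonal:
  fixes A :: "nat \<Rightarrow> nat \<Rightarrow> real"
  assumes "\<And>j k. A j k = A k j" "\<And>j. A j j = 0"
  shows "(\<Sum>j=1..n. \<Sum>k=1..n. A j k) = 2 * (\<Sum>k=2..n. \<Sum>j=1..k - 1. A j k)"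
proof -
  have inner: "(\<Sum>j=1..k. (if j = k then 1 / 2 else 1) * A j k) = (\<Sum>j=1..k - 1. A j k)" for k
    using assms(2) by (intro sum.mono_neutral_cong_right) auto
  have "(\<Sum>k=1..n. \<Sum>j=1..k - 1. A j k) = (\<Sum>k=2..n. \<Sum>j=1..k - 1. A j k)"
    by (intro sum.mono_neutral_right) auto
  then show ?thesis unfolding sum_symmetric[of A, OF assms(1)] inner by simp
qed

lemma sum_lower_triangle: "(\<Sum>k=1..n. k) = n * (n + 1) div 2" for n :: nat
  by (induction n) auto

text \<open>Equality of the node sum with the displayed expression is claimed for every function
  \<open>f\<close>, not just polynomials, which ties the abstract pair \<open>X\<close>,
  \<open>\<mu>\<close> to the explicit formula. The second rule has degree \<open>4 * n - 5\<close>
  and \<open>2n(n - 1)\<close> nodes.\<close>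

theorem theorem3p3:
  fixes w :: "real \<Rightarrow> real" and n :: nat and p :: "real poly"
    and x lam \<theta> :: "nat \<Rightarrow> real"
  assumes "weight_fun w"
    and "n \<ge> 1"
    and "orthogonal_poly w n p"
    and "bij_betw x {1..n} {t. poly p t = 0}"
    and "gauss_quadrature w n x lam"
    and "\<And>k. k \<in> {1..n} \<Longrightarrow> \<theta> k > 0 \<and> x k = cosh (\<theta> k)"
  shows "(\<exists>X \<mu>. minimal_cubature_rule ((c_const w)\<^sup>2) (calW w (- 1 / 2)) G_dom (4 * n - 1) X \<mu> \<and>
            card X = dim_poly2 (2 * n - 1) + n \<and>
            (\<forall>f. (\<Sum>z\<in>X. \<mu> z * f z) = rule_minus n lam \<theta> f) \<and>
            (\<forall>f\<in>poly2 (4 * n - 1).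
               (c_const w)\<^sup>2 * integral_against (calW w (- 1 / 2)) G_dom f = rule_minus n lam \<theta> f))
       \<and> (n \<ge> 2 \<longrightarrow>
          (\<exists>X \<mu>. minimal_cubature_rule ((c_const w)\<^sup>2) (calW w (1 / 2)) G_dom (4 * n - 5) X \<mu> \<and>
            card X = dim_poly2 (2 * n - 3) + n - 1 \<and>
            (\<forall>f. (\<Sum>z\<in>X. \<mu> z * f z) = rule_plus n lam \<theta> f) \<and>
            (\<forall>f\<in>poly2 (4 * n - 5).
               (c_const w)\<^sup>2 * integral_against (calW w (1 / 2)) G_dom f = rule_plus n lam \<theta> f)))"
proof -
  note weight = assms(1) and gauss = assms(5)
  have \<theta>: "\<And>k. k \<in> {1..n} \<Longrightarrow> \<theta> k > 0" and x: "\<And>k. k \<in> {1..n} \<Longrightarrow> x k = cosh (\<theta> k)"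
    using assms(6) by blast+
  have inj: "inj_on x {1..n}" using assms(4) by (rule bij_betw_imp_inj_on)
  let ?s = "\<lambda>p. s_node \<theta> (snd p) (fst p)" and ?t = "\<lambda>p. t_node \<theta> (snd p) (fst p)"
  have st: "0 < ?s p \<and> ?s p < ?t p" if "p \<in> (SIGMA k:{1..n}. {1..k})" for p
    using nodes_ordered[of \<theta> "snd p" "fst p"] \<theta> that by (cases p) auto
  show ?thesis
  proof (intro conjI impI)
    interpret triangle_weight w "- 1 / 2" 0 by unfold_locales (use weight in auto)
    let ?J = "SIGMA k:{1..n}. {1..k}"
    obtain X \<mu> where X: "finite X" "card X = 4 * card ?J"
      and sum_X: "\<And>f. (\<Sum>z\<in>X. \<mu> z * f z) =
        (\<Sum>p\<in>?J. (1 / 4 * ((if snd p = fst p then 1 / 2 else 1) * (lam (snd p) * lam (fst p))))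
           * orbit_sum f (?s p) (?t p))"
      using orbit_rule[of ?J ?s ?t "\<lambda>p. 1 / 4 * ((if snd p = fst p then 1 / 2 else 1) * (lam (snd p) * lam (fst p)))",
          OF _ inj_on_nodes[OF inj x order_refl] st] by blast
    have rule: "(\<Sum>z\<in>X. \<mu> z * f z) = rule_minus n lam \<theta> f" for f
      unfolding sum_X rule_minus_def sum_distrib_left
      by (subst sum.Sigma) (auto simp: case_prod_unfold mult.assoc intro!: sum.cong)
    have exact: "(c_const w)\<^sup>2 * integral_against (calW w (- 1 / 2)) G_dom f = rule_minus n lam \<theta> f"
      if "f \<in> poly2 (4 * n - 1)" for f
    proof -
      \<comment> \<open>Exponent 0 permits \<open>M = 2 * n - 1\<close>, the full degree of the
        Gaussian quadrature.\<close>
      have "2 * (2 * n - 1) + 1 = 4 * n - 1" using \<open>n \<ge> 1\<close> by simp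
      then have "f \<in> poly2 (2 * (2 * n - 1) + 1)" using that by metis
      then have "(c_const w)\<^sup>2 * integral_against (calW w (- 1 / 2)) G_dom f =
          1 / 8 * (\<Sum>j=1..n. \<Sum>k=1..n. lam j * lam k * orbit_sum f (s_node \<theta> j k) (t_node \<theta> j k))"
        using cubature_formula[OF _ gauss x] by simp
      then show ?thesis
        by (subst (asm) sum_symmetric)
          (simp_all add: rule_minus_def s_node_commute t_node_commute mult.commute)
    qed
    have card_J: "card ?J = n * (n + 1) div 2" using sum_lower_triangle[of n] by simp
    have "even (n * (n + 1))" by simp
    then have card: "card X = 2 * n * (n + 1)" using X(2) card_J by fastforce
    have "minimal_cubature_rule ((c_const w)\<^sup>2) (calW w (- 1 / 2)) G_dom (4 * n - 1) X \<mu>"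
      using exact rule card X \<open>n \<ge> 1\<close> by (intro minimal_cubature_ruleI) auto
    moreover have "card X = dim_poly2 (2 * n - 1) + n"
      using card \<open>n \<ge> 1\<close> by (simp add: dim_poly2_eq algebra_simps)
    ultimately show "\<exists>X \<mu>. minimal_cubature_rule ((c_const w)\<^sup>2) (calW w (- 1 / 2)) G_dom (4 * n - 1) X \<mu> \<and>
            card X = dim_poly2 (2 * n - 1) + n \<and>
            (\<forall>f. (\<Sum>z\<in>X. \<mu> z * f z) = rule_minus n lam \<theta> f) \<and>
            (\<forall>f\<in>poly2 (4 * n - 1).
               (c_const w)\<^sup>2 * integral_against (calW w (- 1 / 2)) G_dom f = rule_minus n lam \<theta> f)"
      using rule exact by blast
  next
    assume "n \<ge> 2"
    interpret triangle_weight w "1 / 2" 2 by unfold_locales (use weight in auto)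
    \<comment> \<open>Diagonal pairs carry the weight factor 0 and must not be counted as
      nodes.\<close>
    let ?J = "SIGMA k:{2..n}. {1..k - 1}"
    have sub: "?J \<subseteq> (SIGMA k:{1..n}. {1..k})" by auto
    obtain X \<mu> where X: "finite X" "card X = 4 * card ?J"
      and sum_X: "\<And>f. (\<Sum>z\<in>X. \<mu> z * f z) =
        (\<Sum>p\<in>?J. (1 / 4 * (lam (snd p) * lam (fst p) * (cosh (\<theta> (snd p)) - cosh (\<theta> (fst p)))\<^sup>2))
           * orbit_sum f (?s p) (?t p))"
      using orbit_rule[of ?J ?s ?t "\<lambda>p. 1 / 4 * (lam (snd p) * lam (fst p) * (cosh (\<theta> (snd p)) - cosh (\<theta> (fst p)))\<^sup>2)",
          OF _ inj_on_nodes[OF inj x sub] st[OF subsetD[OF sub]]] by blast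
    have rule: "(\<Sum>z\<in>X. \<mu> z * f z) = rule_plus n lam \<theta> f" for f
      unfolding sum_X rule_plus_def sum_distrib_left
      by (subst sum.Sigma) (auto simp: case_prod_unfold mult.assoc intro!: sum.cong)
    have exact: "(c_const w)\<^sup>2 * integral_against (calW w (1 / 2)) G_dom f = rule_plus n lam \<theta> f"
      if "f \<in> poly2 (4 * n - 5)" for f
    proof -
      define A where "A j k = lam j * lam k * (cosh (\<theta> j) - cosh (\<theta> k))\<^sup>2 *
        orbit_sum f (s_node \<theta> j k) (t_node \<theta> j k)" for j k
      \<comment> \<open>The squared difference uses up two degrees in each variable, leaving
        \<open>M = 2 * n - 3\<close>.\<close>
      have "2 * (2 * n - 3) + 1 = 4 * n - 5" using \<open>n \<ge> 2\<close> by simp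
      then have "f \<in> poly2 (2 * (2 * n - 3) + 1)" using that by metis
      then have "(c_const w)\<^sup>2 * integral_against (calW w (1 / 2)) G_dom f =
          1 / 8 * (\<Sum>j=1..n. \<Sum>k=1..n. lam j * lam k * (x k - x j)\<^sup>2 *
            orbit_sum f (s_node \<theta> j k) (t_node \<theta> j k))"
        using cubature_formula[OF _ gauss x] \<open>n \<ge> 2\<close> by simp
      also have "\<dots> = 1 / 8 * (\<Sum>j=1..n. \<Sum>k=1..n. A j k)"
        using x by (simp add: A_def power2_commute)
      also have "\<dots> = 1 / 4 * (\<Sum>k=2..n. \<Sum>j=1..k - 1. A j k)"
        by (subst sum_symmetric_zero_diagonal)
          (simp_all add: A_def s_node_commute t_node_commute mult.commute power2_commute)
      finally show ?thesis by (simp add: rule_plus_def A_def)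
    qed
    have "card ?J = (\<Sum>k=2..n. k - 1)" by simp
    also have "\<dots> = (\<Sum>k=1..n - 1. k)"
      by (rule sum.reindex_bij_witness[of _ Suc "\<lambda>k. k - 1"]) auto
    also have "\<dots> = (n - 1) * n div 2" using sum_lower_triangle[of "n - 1"] \<open>n \<ge> 2\<close> by simp
    finally have card_J: "card ?J = (n - 1) * n div 2" .
    obtain m where m: "n = m + 1" "m \<ge> 1" using \<open>n \<ge> 2\<close> by (intro that[of "n - 1"]) auto
    have "even (m * (m + 1))" by simp
    then have card: "card X = 2 * m * (m + 1)" using X(2) card_J m by fastforce
    have deg: "4 * n - 5 = 4 * m - 1" using m by simp
    have "minimal_cubature_rule ((c_const w)\<^sup>2) (calW w (1 / 2)) G_dom (4 * n - 5) X \<mu>"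
      unfolding deg using exact rule card X m by (intro minimal_cubature_ruleI) auto
    moreover have "card X = dim_poly2 (2 * n - 3) + n - 1"
    proof -
      have "2 * n - 3 = 2 * m - 1" using m by simp
      then show ?thesis using card m by (simp add: dim_poly2_eq algebra_simps)
    qed
    ultimately show "\<exists>X \<mu>. minimal_cubature_rule ((c_const w)\<^sup>2) (calW w (1 / 2)) G_dom (4 * n - 5) X \<mu> \<and>
            card X = dim_poly2 (2 * n - 3) + n - 1 \<and>
            (\<forall>f. (\<Sum>z\<in>X. \<mu> z * f z) = rule_plus n lam \<theta> f) \<and>
            (\<forall>f\<in>poly2 (4 * n - 5).
               (c_const w)\<^sup>2 * integral_against (calW w (1 / 2)) G_dom f = rule_plus n lam \<theta> f)"
      using rule exact by blast
  qed
qed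

end
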